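(* Let $q$ be a polynomial and let $p_1,p_2,\alpha_1,\alpha_2$ be nonzero complex constants with $\alpha_1\neq\alpha_2$. Suppose $f$ is an entire function with $\rho_2(f)<1$ satisfying $$f(z)^3+q(z)\,\Delta f(z)=p_1e^{\alpha_1 z}+p_2e^{\alpha_2 z}\quad (z\in\mathbb{C}),$$ where $\Delta f(z)=f(z+1)-f(z)$. Then $q$ is a constant, and one of the following holds: (1) $f(z)=e_1e^{\alpha_1 z/3}+e_2e^{\alpha_2 z/3}$, where $e_1,e_2$ are nonzero constants with $e_1^3=p_1$, $e_2^3=p_2$ (or $e_1^3=p_2$, $e_2^3=p_1$), $3e_1e_2-2q=0$, $\alpha_1+\alpha_2=0$ and $e^{\alpha_1/3}=-1$; (2) $f(z)=c_1e^{\alpha_1 z/3}$ with $c_1^3=p_1$, $c_1\left(e^{\alpha_1/3}-1\right)q=p_2$ and $\alpha_1=3\alpha_2$; (3) $f(z)=c_2e^{\alpha_2 z/3}$ with $c_2^3=p_2$, $c_2\left(e^{\alpha_2/3}-1\right)q=p_1$ and $\alpha_2=3\alpha_1$.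
   Context: For a meromorphic function $f$ on $\mathbb{C}$ with Nevanlinna characteristic $T(r,f)$, the hyper-order is $\rho_2(f)=\limsup_{r\to\infty}\frac{\log\log T(r,f)}{\log r}$. *)

theory Defs
  imports "HOL-Analysis.Analysis" "HOL-Computational_Algebra.Polynomial"
begin

definition log_plus :: "real \<Rightarrow> real" where
  "log_plus x = max 0 (ln x)"

text \<open>Nevanlinna characteristic of an entire function. For entire f the
  counting function of poles N(r,f) vanishes, so T(r,f) = m(r,f), the
  proximity function (1/(2 pi)) * integral over [0,2 pi] of log^+ |f(r e^{i t})|.\<close>
definition nev_T :: "(complex \<Rightarrow> complex) \<Rightarrow> real \<Rightarrow> real" where
  "nev_T f r = (1 / (2 * pi)) * integral {0..2*pi} (\<lambda>t. log_plus (norm (f (of_real r * cis t))))"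

definition hyper_order :: "(complex \<Rightarrow> complex) \<Rightarrow> ereal" where
  "hyper_order f = Limsup at_top (\<lambda>r::real. ereal (ln (ln (nev_T f r)) / ln r))"

end

theory Submission
  imports Defs "HOL-Complex_Analysis.Complex_Analysis" "HOL-Real_Asymp.Real_Asymp"
begin

text \<open>Write \<open>R\<close> for the right-hand side and \<open>C = q \<Delta>f\<close>, so that \<open>f\<^sup>3 = R - C\<close>. If \<open>f\<close> were somewhere much
  larger than \<open>R\<^bsup>1/3\<^esup>\<close>, the equation would force \<open>|f(z + 1)|\<close> to be about \<open>|f(z)|\<^sup>3\<close>, and iterating this
  contradicts hyper-order less than one. Hence \<open>f\<close>, \<open>f'\<close>, \<open>C\<close> and \<open>C'\<close> are bounded by a polynomial times
  \<open>exp (h / 3)\<close>, where \<open>h\<close> is the maximum of \<open>0\<close>, \<open>Re (\<alpha>1 z)\<close> and \<open>Re (\<alpha>2 z)\<close>.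

  Comparing \<open>3 f\<^sup>2 f' = R' - C'\<close> with \<open>f\<^sup>3 = -C\<close> at the zeros of \<open>R\<close> shows that \<open>\<alpha>2 = t \<alpha>1\<close> with \<open>t\<close> real.
  By symmetry \<open>-1 \<le> t < 1\<close>. Then \<open>u = 3 f' - \<alpha>1 f\<close> or, for \<open>t > 2/3\<close>, \<open>3 f' R - f R'\<close> is small in the
  half-plane \<open>Re (\<alpha>1 z) \<ge> 0\<close>, because its product with \<open>f\<^sup>2\<close> involves only \<open>C\<close>, \<open>C'\<close> and lower
  exponentials. After multiplication by an exponential it is polynomially bounded everywhere, hence a
  polynomial, and this leaves a first-order linear equation for \<open>f\<close>. The resulting exponential
  polynomial is determined by the linear independence of exponentials over the polynomials.\<close>

section \<open>Pointwise growth from the characteristic\<close>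

text \<open>On the unit circle \<open>w * cnj w = 1\<close> lowers the degree of the mixed product,
  and an antiholomorphic term has the same real part as its conjugate.\<close>

lemma Re_mult_cnj_poly:
  "\<exists>S. \<forall>w. norm w = 1 \<longrightarrow> Re (poly P w * cnj (poly Q w)) = Re (poly S w)"
proof (induction P arbitrary: Q)
  case 0
  then show ?case by (intro exI[of _ 0]) auto
next
  case (pCons a P)
  obtain b Q' where Q: "Q = pCons b Q'" by (cases Q) auto
  obtain S where S: "\<And>w. norm w = 1 \<Longrightarrow> Re (poly P w * cnj (poly Q' w)) = Re (poly S w)"
    using pCons.IH by blast
  let ?S = "[:a * cnj b:] + smult (cnj a) (pCons 0 Q') + smult (cnj b) (pCons 0 P) + S"
  show ?case
  proof (intro exI[of _ ?S] allI impI)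
    fix w :: complex assume w: "norm w = 1"
    define p r where "p = poly P w" and "r = poly Q' w"
    have ww: "w * cnj w = 1" using w by (simp add: complex_norm_square[symmetric])
    have "(a + w * p) * cnj (b + w * r)
        = a * cnj b + cnj (cnj a * (w * r)) + cnj b * (w * p) + (w * cnj w) * (p * cnj r)"
      by (simp add: algebra_simps)
    then have "Re ((a + w * p) * cnj (b + w * r))
        = Re (a * cnj b) + Re (cnj a * (w * r)) + Re (cnj b * (w * p)) + Re (p * cnj r)"
      unfolding ww by (simp only: plus_complex.sel mult_1_left cnj.sel)
    moreover have "Re (p * cnj r) = Re (poly S w)"
      using S[OF w] by (simp add: p_def r_def)
    moreover have "Re (poly ?S w)
        = Re (a * cnj b) + Re (cnj a * (w * r)) + Re (cnj b * (w * p)) + Re (poly S w)"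
      by (simp only: poly_add poly_smult poly_pCons poly_0 plus_complex.sel p_def r_def
          mult_zero_right add_0_left add_0_right)
    ultimately show "Re (poly (pCons a P) w * cnj (poly Q w)) = Re (poly ?S w)"
      by (simp only: Q p_def r_def poly_pCons)
  qed
qed

text \<open>Turns a Stone-Weierstrass approximant on the circle into the boundary values of an
  explicit harmonic function.\<close>

lemma real_polynomial_function_on_circle:
  fixes g :: "complex \<Rightarrow> real"
  assumes "real_polynomial_function g"
  shows "\<exists>P. \<forall>w. norm w = 1 \<longrightarrow> g w = Re (poly P w)"
  using assms
proof (induction g rule: real_polynomial_function.induct)
  case (linear g)
  have "g w = Re (poly [:0, of_real (g 1) - \<i> * of_real (g \<i>):] w)" for w
  proof -
    interpret bounded_linear g by fact
    have "g w = g (Re w *\<^sub>R 1 + Im w *\<^sub>R \<i>)"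
      by (rule arg_cong[of _ _ g]) (simp add: complex_eq_iff)
    also have "\<dots> = Re w * g 1 + Im w * g \<i>"
      by (simp only: add scaleR real_scaleR_def)
    finally show ?thesis by simp
  qed
  then show ?case by blast
next
  case (const c)
  then show ?case by (intro exI[of _ "[:of_real c:]"]) auto
next
  case (add f g)
  then obtain P Q where "\<forall>w. norm w = 1 \<longrightarrow> f w = Re (poly P w)"
      "\<forall>w. norm w = 1 \<longrightarrow> g w = Re (poly Q w)" by blast
  then show ?case by (intro exI[of _ "P + Q"]) auto
next
  case (mult f g)
  then obtain P Q where PQ: "\<And>w. norm w = 1 \<Longrightarrow> f w = Re (poly P w)"
      "\<And>w. norm w = 1 \<Longrightarrow> g w = Re (poly Q w)" by blast
  obtain S where S: "\<And>w. norm w = 1 \<Longrightarrow> Re (poly P w * cnj (poly Q w)) = Re (poly S w)"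
    using Re_mult_cnj_poly by blast
  \<comment> \<open>\<open>Re p * Re r\<close> is half of
    \<open>Re (p * r) + Re (p * cnj r)\<close>; the second summand is supplied by
    \<open>S\<close>.\<close>
  have "f w * g w = Re (poly (smult (1/2) (P * Q + S)) w)" if "norm w = 1" for w
    using S[OF that] by (simp add: PQ that)
  then show ?case by blast
qed

lemma has_integral_cis_int:
  "((\<lambda>t. cis (of_int m * t)) has_integral (if m = 0 then 2 * pi else 0)) {0..2*pi}"
proof (cases "m = 0")
  case True
  have "((\<lambda>t::real. 1::complex) has_integral (2 * pi - 0) *\<^sub>R 1) {0..2*pi}"
    using has_integral_const_real[of "1::complex" 0 "2*pi"] by simp
  then show ?thesis using True by (simp add: scaleR_conv_of_real)
next
  case False
  have "((\<lambda>t. cis (of_int m * t)) has_integral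
      (cis (of_int m * (2*pi)) / (\<i> * of_int m) - cis (of_int m * 0) / (\<i> * of_int m))) {0..2*pi}"
  proof (rule fundamental_theorem_of_calculus)
    fix t
    have "((\<lambda>t. exp (\<i> * of_int m * of_real t) / (\<i> * of_int m)) has_vector_derivative
        exp (\<i> * of_int m * of_real t)) (at t within {0..2*pi})"
      using False
      by (auto intro!: derivative_eq_intros has_vector_derivative_real_field)
    then show "((\<lambda>t. cis (of_int m * t) / (\<i> * of_int m)) has_vector_derivative
        cis (of_int m * t)) (at t within {0..2*pi})"
      by (simp add: cis_conv_exp mult_ac)
  qed auto
  moreover have "cis (of_int m * (2*pi)) = 1"
    by (metis cis_multiple_2pi Ints_of_int mult.commute)
  ultimately show ?thesis using False by simp
qed

lemma has_integral_poly_cis: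
  "((\<lambda>t. poly P (cis t) * cis (of_int m * t)) has_integral
     (2 * pi * (if m \<le> 0 then coeff P (nat (- m)) else 0))) {0..2*pi}"
proof -
  have "((\<lambda>t. \<Sum>i\<le>degree P. coeff P i * cis (of_int (int i + m) * t)) has_integral
     (\<Sum>i\<le>degree P. coeff P i * (if int i + m = 0 then 2 * pi else 0))) {0..2*pi}"
    by (intro has_integral_sum has_integral_mult_right has_integral_cis_int) auto
  moreover have "(\<Sum>i\<le>degree P. coeff P i * (if int i + m = 0 then 2 * pi else 0))
      = 2 * pi * (if m \<le> 0 then coeff P (nat (- m)) else 0)"
  proof (cases "m \<le> 0")
    case True
    then have eq: "int i + m = 0 \<longleftrightarrow> i = nat (- m)" for i by auto
    show ?thesis unfolding eq using True
      by (auto simp: if_distrib sum.delta coeff_eq_0 cong: if_cong)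
  qed auto
  moreover have "(\<Sum>i\<le>degree P. coeff P i * cis (of_int (int i + m) * t))
      = poly P (cis t) * cis (of_int m * t)" for t
    by (simp add: poly_altdef sum_distrib_right Complex.DeMoivre ring_distribs mult.assoc flip: cis_mult)
  ultimately show ?thesis by simp
qed

lemma integral_Re_poly_cis:
  "((\<lambda>t. Re (poly P (cis t))) has_integral (2 * pi * Re (coeff P 0))) {0..2*pi}"
  using has_integral_linear[OF has_integral_poly_cis[of P 0] bounded_linear_Re]
  by (simp add: o_def)

text \<open>The bound on the nonconstant coefficients is Caratheodory's inequality for functions
  with nonnegative real part.\<close>
lemma Re_poly_Harnack:
  assumes nn: "\<And>w. norm w = 1 \<Longrightarrow> 0 \<le> Re (poly P w)" and w: "norm w \<le> 1 / 2"
  shows "Re (poly P w) \<le> 3 * Re (coeff P 0)"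
proof -
  define c where "c = Re (coeff P 0)"
  have coeff_le: "norm (coeff P k) \<le> 2 * c" if k: "k \<ge> 1" for k
  proof -
    \<comment> \<open>For \<open>k \<ge> 1\<close> the second integral vanishes, so adding it
      changes nothing, but it turns \<open>poly P\<close> into twice its real part, whose sign is
      known.\<close>
    let ?g = "\<lambda>t. poly P (cis t) * cis (of_int (- int k) * t) + cnj (poly P (cis t) * cis (of_int (int k) * t))"
    have "(?g has_integral (2 * pi * coeff P k + cnj 0)) {0..2*pi}"
      using has_integral_linear[OF has_integral_poly_cis[of P "int k"] bounded_linear_cnj]
        has_integral_poly_cis[of P "- int k"] k
      by (intro has_integral_add) (simp_all add: o_def)
    moreover have "?g t = of_real (2 * Re (poly P (cis t))) * cis (- real k * t)" for t
    proof -
      have "?g t = (poly P (cis t) + cnj (poly P (cis t))) * cis (- real k * t)"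
        by (simp add: cis_cnj algebra_simps)
      then show ?thesis by (simp only: complex_add_cnj)
    qed
    ultimately have I: "((\<lambda>t. of_real (2 * Re (poly P (cis t))) * cis (- real k * t))
        has_integral (2 * pi * coeff P k)) {0..2*pi}" by simp
    have J: "((\<lambda>t. 2 * Re (poly P (cis t))) has_integral (2 * (2 * pi * c))) {0..2*pi}"
      unfolding c_def by (intro has_integral_mult_right integral_Re_poly_cis)
    have "norm (integral {0..2*pi} (\<lambda>t. of_real (2 * Re (poly P (cis t))) * cis (- real k * t)))
        \<le> integral {0..2*pi} (\<lambda>t. 2 * Re (poly P (cis t)))"
      using I J nn by (intro integral_norm_bound_integral) (auto simp: norm_mult)
    then have "norm (2 * pi * coeff P k) \<le> 2 * (2 * pi * c)"
      by (simp only: integral_unique[OF I] integral_unique[OF J])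
    then show ?thesis by (simp add: norm_mult)
  qed
  have c0: "0 \<le> c" using order_trans[OF norm_ge_zero coeff_le[of 1]] by simp
  have "poly P w = coeff P 0 + (\<Sum>i\<in>{1..degree P}. coeff P i * w ^ i)"
    unfolding poly_altdef atMost_atLeast0 by (subst sum.atLeast_Suc_atMost) auto
  then have "Re (poly P w) \<le> c + norm (\<Sum>i\<in>{1..degree P}. coeff P i * w ^ i)"
    unfolding c_def using complex_Re_le_cmod by (simp del: Re_sum)
  also have "norm (\<Sum>i\<in>{1..degree P}. coeff P i * w ^ i) \<le> (\<Sum>i\<in>{1..degree P}. 2 * c * (1/2) ^ i)"
    using w coeff_le c0
    by (intro sum_norm_le) (auto simp: norm_mult norm_power intro!: mult_mono power_mono)
  also have "\<dots> = 2 * c * (\<Sum>i\<in>{1..degree P}. (1/2) ^ i)" by (simp add: sum_distrib_left)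
  \<comment> \<open>With coefficients bounded by \<open>2 * c\<close>, the geometric series adds at
    most \<open>2 * c\<close> to the constant term; hence the factor 3.\<close>
  also have "(\<Sum>i\<in>{1..degree P}. (1/2::real) ^ i) \<le> 1"
    by (simp add: sum_gp)
  finally show ?thesis using c0 by (simp add: c_def mult_left_mono)
qed

text \<open>The form with \<open>max 1\<close> is visibly continuous in \<open>y\<close>, as the
  approximation needs; at \<open>y = 0\<close> both sides are 0 because
  \<open>ln 0 = 0\<close>.\<close>

lemma log_plus_norm: "log_plus (norm y) = ln (max 1 (norm y))"
proof (cases "norm y \<le> 1")
  case True
  then have "ln (norm y) \<le> 0" by (cases "y = 0") auto
  then show ?thesis using True by (simp add: log_plus_def max_def)
qed (simp add: log_plus_def max_def)

text \<open>Instead of the Poisson integral, the harmonic majorant of \<open>log\<^sup>+ |f|\<close> is the real part of a polynomial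
  obtained by uniform approximation on the circle; the additive constant \<open>6\<close> absorbs the error.\<close>
lemma norm_le_exp_nev_T:
  assumes hol: "f holomorphic_on UNIV" and "0 < r" and z: "norm z \<le> r"
  shows "norm (f z) \<le> exp (3 * nev_T f (2 * r) + 6)"
proof -
  have cont: "continuous_on A f" for A
    using hol holomorphic_on_imp_continuous_on continuous_on_subset by blast
  define u where "u = (\<lambda>w. ln (max 1 (norm (f (of_real (2 * r) * w)))))"
  have contu: "continuous_on A u" for A
    unfolding u_def
    by (intro continuous_intros continuous_on_compose2[OF cont[of UNIV]]) auto
  \<comment> \<open>Approximating \<open>u + 1\<close> to within 1 places \<open>g\<close> between
    \<open>u\<close> and \<open>u + 2\<close>, so that it is a majorant.\<close>
  obtain g where "real_polynomial_function g" and g: "\<And>w. w \<in> sphere 0 1 \<Longrightarrow> \<bar>u w + 1 - g w\<bar> < 1"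
  proof (rule Stone_Weierstrass_real_polynomial_function[of "sphere 0 1" "\<lambda>w. u w + 1" 1])
    show "continuous_on (sphere 0 1) (\<lambda>w. u w + 1)" by (intro continuous_intros contu)
  qed auto
  then obtain P where P: "\<And>w. norm w = 1 \<Longrightarrow> g w = Re (poly P w)"
    using real_polynomial_function_on_circle by blast
  have uP: "u w \<le> Re (poly P w)" "Re (poly P w) \<le> u w + 2" if "norm w = 1" for w
    using g[of w] P[OF that] that by (auto simp: abs_less_iff)
  have u0: "0 \<le> u w" for w unfolding u_def by simp
  have nu: "norm (f (of_real (2 * r) * w)) \<le> exp (u w)" for w unfolding u_def by simp
  define w where "w = z / of_real (2 * r)"
  have zw: "z = of_real (2 * r) * w" using \<open>0 < r\<close> by (simp add: w_def)
  have w: "norm w \<le> 1 / 2" using z \<open>0 < r\<close> by (simp add: w_def norm_divide norm_mult field_simps)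
  \<comment> \<open>The maximum modulus principle for the quotient by \<open>exp (poly P w)\<close>
    carries the majorant into the disc without logarithms at zeros of \<open>f\<close>.\<close>
  have "norm (f (of_real (2 * r) * w) * exp (- poly P w)) \<le> 1"
  proof (rule maximum_modulus_frontier[of "\<lambda>w. f (of_real (2 * r) * w) * exp (- poly P w)" "cball 0 1"])
    show "(\<lambda>w. f (complex_of_real (2 * r) * w) * exp (- poly P w)) holomorphic_on interior (cball 0 1)"
      by (intro holomorphic_intros holomorphic_on_compose_gen[OF _ hol, unfolded o_def]) auto
    show "continuous_on (closure (cball 0 1)) (\<lambda>w. f (complex_of_real (2 * r) * w) * exp (- poly P w))"
      by (intro continuous_intros continuous_on_compose2[OF cont[of UNIV]]) auto
    fix v :: complex assume "v \<in> frontier (cball 0 1)"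
    then have v: "norm v = 1" by (simp add: frontier_cball)
    have "norm (f (of_real (2 * r) * v)) * exp (- Re (poly P v)) \<le> exp (u v) * exp (- Re (poly P v))"
      by (intro mult_right_mono nu) auto
    also have "\<dots> \<le> 1" using uP(1)[OF v] by (simp flip: exp_add)
    finally show "norm (f (of_real (2 * r) * v) * exp (- poly P v)) \<le> 1"
      by (simp add: norm_mult)
  qed (use w in auto)
  then have "norm (f z) * exp (- Re (poly P w)) \<le> 1"
    unfolding zw[symmetric] by (simp add: norm_mult)
  then have "norm (f z) \<le> exp (Re (poly P w))"
    by (simp add: exp_minus field_simps)
  also have "Re (poly P w) \<le> 3 * Re (coeff P 0)"
    using order_trans[OF u0 uP(1)] by (intro Re_poly_Harnack[OF _ w])
  also have "Re (coeff P 0) \<le> nev_T f (2 * r) + 2"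
  proof -
    have int: "(\<lambda>t. u (cis t)) integrable_on {0..2*pi}"
      by (intro integrable_continuous_real continuous_on_compose2[OF contu[of UNIV]] continuous_intros) auto
    have T: "integral {0..2*pi} (\<lambda>t. u (cis t)) = 2 * pi * nev_T f (2 * r)"
      by (simp add: nev_T_def log_plus_norm u_def)
    have "2 * pi * Re (coeff P 0) \<le> integral {0..2*pi} (\<lambda>t. u (cis t)) + 2 * (2 * pi)"
    proof (rule has_integral_le[OF integral_Re_poly_cis])
      show "((\<lambda>t. u (cis t) + 2) has_integral (integral {0..2*pi} (\<lambda>t. u (cis t)) + 2 * (2 * pi))) {0..2*pi}"
        using has_integral_add[OF integrable_integral[OF int] has_integral_const_real[of "2::real" 0 "2*pi"]]
        by (simp add: mult.commute)
    qed (use uP(2) in auto)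
    then have "2 * pi * Re (coeff P 0) \<le> 2 * pi * (nev_T f (2 * r) + 2)"
      unfolding T by (simp add: algebra_simps)
    then show ?thesis by simp
  qed
  finally show ?thesis by simp
qed

text \<open>For \<open>s\<close> strictly between the hyper-order and 1,
  \<open>ln (nev_T f r)\<close> is eventually at most \<open>r powr s\<close>, which is below any
  positive multiple of \<open>r\<close>.\<close>

lemma eventually_nev_T_le_exp:
  assumes "hyper_order f < 1" and "0 < d"
  shows "eventually (\<lambda>r. nev_T f r \<le> exp (d * r)) at_top"
proof -
  obtain s where s: "hyper_order f < ereal s" "s < 1"
    using ereal_dense2[OF assms(1)] by (auto simp: one_ereal_def)
  have "eventually (\<lambda>r. ereal (ln (ln (nev_T f r)) / ln r) < ereal s) at_top"
    using s(1) unfolding hyper_order_def by (rule Limsup_lessD)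
  moreover have "eventually (\<lambda>r::real. r powr s \<le> d * r) at_top"
    using assms(2) s(2) by real_asymp
  moreover have "eventually (\<lambda>r::real. r > 1) at_top" by (rule eventually_gt_at_top)
  ultimately show ?thesis
  proof eventually_elim
    case (elim r)
    \<comment> \<open>If \<open>nev_T f r \<le> 1\<close>, the iterated logarithm carries no
      information, but the bound is trivial.\<close>
    show ?case
    proof (cases "nev_T f r \<le> 1")
      case True
      also have "1 \<le> exp (d * r)" using elim assms(2) by simp
      finally show ?thesis .
    next
      case False
      have "ln (ln (nev_T f r)) \<le> s * ln r"
        using elim by (simp add: divide_simps)
      then have "exp (ln (ln (nev_T f r))) \<le> r powr s"
        using elim by (simp add: powr_def)
      then have "ln (nev_T f r) \<le> d * r" using False elim by simp
      then have "exp (ln (nev_T f r)) \<le> exp (d * r)" by simp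
      then show ?thesis using False by simp
    qed
  qed
qed

text \<open>The logarithm of the modulus at the \<open>n\<close>-th translate is
  \<open>O(exp (n / 2))\<close>, and \<open>exp (1 / 2) < 3\<close>. The rate 1/4 allows for the
  doubled radius in \<open>norm_le_exp_nev_T\<close>.\<close>

lemma translates_below_triple_powers:
  assumes hol: "f holomorphic_on UNIV" and ho: "hyper_order f < 1" and l: "1 < l"
  shows "\<exists>n. norm (f (z + of_nat n)) < l ^ (3 ^ n)"
proof -
  define c where "c = norm z + 1"
  have "eventually (\<lambda>r. nev_T f r \<le> exp (1/4 * r)) at_top"
    by (rule eventually_nev_T_le_exp[OF ho]) simp
  moreover have "filterlim (\<lambda>n. 2 * (c + real n)) at_top sequentially" by real_asymp
  ultimately have "eventually (\<lambda>n. nev_T f (2 * (c + real n)) \<le> exp (1/4 * (2 * (c + real n)))) sequentially"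
    by (rule eventually_compose_filterlim)
  moreover have "eventually (\<lambda>n. 3 * exp (1/4 * (2 * (c + real n))) + 6 < ln l * 3 ^ n) sequentially"
  proof -
    have "exp (1/2 :: real) < 3"
    proof -
      have "exp (1/2::real) \<le> exp 1" by simp
      then show ?thesis using e_less_272 by linarith
    qed
    then have "exp (1/2) < exp (ln (3::real))" by simp
    then have "1/2 < ln (3::real)" by (subst (asm) exp_less_cancel_iff)
    moreover have "0 < ln l" using l by simp
    ultimately have "eventually (\<lambda>n. 3 * exp (1/4 * (2 * (c + real n))) + 6 < ln l * exp (ln 3 * real n)) sequentially"
      by real_asymp
    moreover have "exp (ln 3 * real n) = 3 ^ n" for n
      using exp_of_nat_mult[of n "ln (3::real)"] by (simp add: mult.commute)
    ultimately show ?thesis by (simp only:)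
  qed
  ultimately have "eventually (\<lambda>n. norm (f (z + of_nat n)) < l ^ (3 ^ n)) sequentially"
  proof eventually_elim
    case (elim n)
    have "norm (z + of_nat n) \<le> c + real n"
      unfolding c_def by (rule norm_triangle_le) simp
    moreover have "0 < c + real n" using norm_ge_zero[of z] unfolding c_def by linarith
    ultimately have "norm (f (z + of_nat n)) \<le> exp (3 * nev_T f (2 * (c + real n)) + 6)"
      by (intro norm_le_exp_nev_T[OF hol])
    also have "\<dots> < exp (ln l * 3 ^ n)" using elim by simp
    also have "\<dots> = l ^ (3 ^ n)"
      using l exp_of_nat_mult[of "3 ^ n" "ln l"] by (simp add: mult.commute)
    finally show ?case .
  qed
  then show ?thesis by (auto simp: eventually_sequentially)
qed

section \<open>Growth up to polynomial factors\<close>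

text \<open>Growth on the exponential scale: the hidden polynomial factor absorbs \<open>q\<close>
  and all constants, so that only the exponent \<open>k\<close> has to be tracked.\<close>

definition pgrow :: "complex set \<Rightarrow> (complex \<Rightarrow> real) \<Rightarrow> (complex \<Rightarrow> complex) \<Rightarrow> bool" where
  "pgrow S k F \<longleftrightarrow> (\<exists>K D. \<forall>z\<in>S. norm (F z) \<le> K * (1 + norm z) ^ D * exp (k z))"

lemma pgrowI: "(\<And>z. z \<in> S \<Longrightarrow> norm (F z) \<le> K * (1 + norm z) ^ D * exp (k z)) \<Longrightarrow> pgrow S k F"
  by (auto simp: pgrow_def)

lemma pgrowE:
  assumes "pgrow S k F"
  obtains K D where "1 \<le> K" "\<And>z. z \<in> S \<Longrightarrow> norm (F z) \<le> K * (1 + norm z) ^ D * exp (k z)"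
proof -
  obtain K D where *: "\<forall>z\<in>S. norm (F z) \<le> K * (1 + norm z) ^ D * exp (k z)"
    using assms by (auto simp: pgrow_def)
  show thesis
  proof (rule that[of "max 1 K" D])
    fix z assume "z \<in> S"
    then have "norm (F z) \<le> K * ((1 + norm z) ^ D * exp (k z))" using * by (simp add: mult.assoc)
    also have "\<dots> \<le> max 1 K * ((1 + norm z) ^ D * exp (k z))" by (intro mult_right_mono) auto
    finally show "norm (F z) \<le> max 1 K * (1 + norm z) ^ D * exp (k z)" by (simp add: mult.assoc)
  qed simp
qed

lemma pgrow_mono:
  assumes "pgrow S k F" "T \<subseteq> S" "\<And>z. z \<in> T \<Longrightarrow> norm (G z) \<le> norm (F z)"
    "\<And>z. z \<in> T \<Longrightarrow> k z \<le> k' z + c"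
  shows "pgrow T k' G"
proof -
  obtain K D where K: "1 \<le> K" "\<And>z. z \<in> S \<Longrightarrow> norm (F z) \<le> K * (1 + norm z) ^ D * exp (k z)"
    using pgrowE[OF assms(1)] by blast
  show ?thesis
  proof (rule pgrowI[where K = "K * exp c" and D = D])
    fix z assume z: "z \<in> T"
    have "norm (G z) \<le> K * (1 + norm z) ^ D * exp (k z)"
      using assms(2,3) K(2) z by (meson order_trans subsetD)
    also have "\<dots> \<le> K * (1 + norm z) ^ D * exp (k' z + c)"
      using assms(4)[OF z] K(1) by (intro mult_left_mono) auto
    finally show "norm (G z) \<le> K * exp c * (1 + norm z) ^ D * exp (k' z)"
      by (simp add: exp_add mult_ac)
  qed
qed

lemma pgrow_weaken:
  "pgrow S k F \<Longrightarrow> T \<subseteq> S \<Longrightarrow> (\<And>z. z \<in> T \<Longrightarrow> k z \<le> k' z) \<Longrightarrow> pgrow T k' F"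
  by (rule pgrow_mono[where c = 0]) auto

lemma pgrow_mult:
  assumes "pgrow S k F" "pgrow S l G"
  shows "pgrow S (\<lambda>z. k z + l z) (\<lambda>z. F z * G z)"
proof -
  obtain K D where K: "1 \<le> K" "\<And>z. z \<in> S \<Longrightarrow> norm (F z) \<le> K * (1 + norm z) ^ D * exp (k z)"
    using pgrowE[OF assms(1)] by blast
  obtain L E where L: "1 \<le> L" "\<And>z. z \<in> S \<Longrightarrow> norm (G z) \<le> L * (1 + norm z) ^ E * exp (l z)"
    using pgrowE[OF assms(2)] by blast
  show ?thesis
  proof (rule pgrowI[where K = "K * L" and D = "D + E"])
    fix z assume z: "z \<in> S"
    have "norm (F z * G z) \<le> (K * (1 + norm z) ^ D * exp (k z)) * (L * (1 + norm z) ^ E * exp (l z))"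
      unfolding norm_mult using K(1) by (intro mult_mono K(2) L(2) z) auto
    then show "norm (F z * G z) \<le> K * L * (1 + norm z) ^ (D + E) * exp (k z + l z)"
      by (simp add: exp_add power_add mult_ac)
  qed
qed

lemma pgrow_add:
  assumes "pgrow S k F" "pgrow S k G"
  shows "pgrow S k (\<lambda>z. F z + G z)"
proof -
  obtain K D where K: "1 \<le> K" "\<And>z. z \<in> S \<Longrightarrow> norm (F z) \<le> K * (1 + norm z) ^ D * exp (k z)"
    using pgrowE[OF assms(1)] by blast
  obtain L E where L: "1 \<le> L" "\<And>z. z \<in> S \<Longrightarrow> norm (G z) \<le> L * (1 + norm z) ^ E * exp (k z)"
    using pgrowE[OF assms(2)] by blast
  show ?thesis
  proof (rule pgrowI[where K = "K + L" and D = "D + E"])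
    fix z assume z: "z \<in> S"
    have "norm (F z + G z) \<le> K * (1 + norm z) ^ D * exp (k z) + L * (1 + norm z) ^ E * exp (k z)"
      using K(2)[OF z] L(2)[OF z] by (intro norm_triangle_le) linarith
    also have "\<dots> \<le> K * (1 + norm z) ^ (D + E) * exp (k z) + L * (1 + norm z) ^ (D + E) * exp (k z)"
      using K(1) L(1) by (intro add_mono mult_right_mono mult_left_mono power_increasing) auto
    finally show "norm (F z + G z) \<le> (K + L) * (1 + norm z) ^ (D + E) * exp (k z)"
      by (simp add: algebra_simps)
  qed
qed

lemma pgrow_uminus: "pgrow S k F \<Longrightarrow> pgrow S k (\<lambda>z. - F z)"
  by (rule pgrow_mono[where c = 0]) auto

lemma pgrow_diff: "pgrow S k F \<Longrightarrow> pgrow S k G \<Longrightarrow> pgrow S k (\<lambda>z. F z - G z)"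
  using pgrow_add[OF _ pgrow_uminus] by force

lemma pgrow_const: "pgrow S (\<lambda>_. 0) (\<lambda>_. c)"
  by (rule pgrowI[where K = "norm c" and D = 0]) auto

lemma pgrow_cmult: "pgrow S k F \<Longrightarrow> pgrow S k (\<lambda>z. c * F z)"
  using pgrow_mult[OF pgrow_const] by force

lemma pgrow_exp: "pgrow S (\<lambda>z. Re (a * z)) (\<lambda>z. exp (a * z))"
  by (rule pgrowI[where K = 1 and D = 0]) auto

lemma pgrow_poly: "pgrow S (\<lambda>_. 0) (poly p)"
proof (induction p)
  case 0
  then show ?case using pgrow_const[of S 0] by (simp add: poly_0)
next
  case (pCons c p)
  have "pgrow S (\<lambda>_. 0) (\<lambda>z. z)"
    by (rule pgrowI[where K = 1 and D = 1]) auto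
  from pgrow_add[OF pgrow_const[of S c] pgrow_mult[OF this pCons.IH, simplified]]
  show ?case by simp
qed

lemma pgrow_Un: "pgrow S k F \<Longrightarrow> pgrow T k F \<Longrightarrow> pgrow (S \<union> T) k F"
proof -
  assume "pgrow S k F" "pgrow T k F"
  obtain K D where K: "1 \<le> K" "\<And>z. z \<in> S \<Longrightarrow> norm (F z) \<le> K * (1 + norm z) ^ D * exp (k z)"
    using pgrowE[OF \<open>pgrow S k F\<close>] by blast
  obtain L E where L: "1 \<le> L" "\<And>z. z \<in> T \<Longrightarrow> norm (F z) \<le> L * (1 + norm z) ^ E * exp (k z)"
    using pgrowE[OF \<open>pgrow T k F\<close>] by blast
  show ?thesis
  proof (rule pgrowI[where K = "max K L" and D = "max D E"])
    fix z assume z: "z \<in> S \<union> T"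
    have "K * (1 + norm z) ^ D * exp (k z) \<le> max K L * (1 + norm z) ^ max D E * exp (k z)"
      using K(1) by (intro mult_right_mono mult_mono power_increasing) auto
    moreover have "L * (1 + norm z) ^ E * exp (k z) \<le> max K L * (1 + norm z) ^ max D E * exp (k z)"
      using L(1) by (intro mult_right_mono mult_mono power_increasing) auto
    ultimately show "norm (F z) \<le> max K L * (1 + norm z) ^ max D E * exp (k z)"
      using z K(2)[of z] L(2)[of z] by (meson UnE order_trans)
  qed
qed

text \<open>The polynomial factor is at least 1, hence below its own cube, and no root of it has to
  be taken.\<close>

lemma pgrow_cube_root:
  assumes "pgrow S k (\<lambda>z. F z ^ 3)"
  shows "pgrow S (\<lambda>z. k z / 3) F"
proof -
  obtain K D where K: "1 \<le> K" "\<And>z. z \<in> S \<Longrightarrow> norm (F z ^ 3) \<le> K * (1 + norm z) ^ D * exp (k z)"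
    using pgrowE[OF assms] by blast
  show ?thesis
  proof (rule pgrowI[where K = K and D = D])
    fix z assume z: "z \<in> S"
    define W where "W = K * (1 + norm z) ^ D"
    have W: "1 \<le> W" unfolding W_def using K(1) by (intro mult_ge1_I) auto
    have "norm (F z) ^ 3 \<le> W * exp (k z)" using K(2)[OF z] by (simp add: norm_power W_def)
    also have "\<dots> \<le> W ^ 3 * exp (k z)" using W by (intro mult_right_mono self_le_power) auto
    also have "\<dots> = (W * exp (k z / 3)) ^ 3"
      using exp_of_nat_mult[of 3 "k z / 3"] by (simp add: power_mult_distrib)
    finally have "norm (F z) \<le> W * exp (k z / 3)"
      using W power_mono_iff[of "norm (F z)" "W * exp (k z / 3)" 3] by simp
    then show "norm (F z) \<le> K * (1 + norm z) ^ D * exp (k z / 3)" by (simp add: W_def)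
  qed
qed

text \<open>Common source of the bounds for shifts and derivatives: both are controlled by
  \<open>F\<close> on the closed unit disc around \<open>z\<close>, where \<open>1 + norm w\<close>
  at most doubles.\<close>

lemma pgrow_local:
  assumes "pgrow UNIV k F"
    and lip: "\<And>z w. norm (w - z) \<le> 1 \<Longrightarrow> k w \<le> k z + H"
    and loc: "\<And>z M. (\<And>w. norm (w - z) \<le> 1 \<Longrightarrow> norm (F w) \<le> M) \<Longrightarrow> norm (G z) \<le> M"
  shows "pgrow UNIV k G"
proof -
  obtain K D where K: "1 \<le> K" "\<And>z. z \<in> UNIV \<Longrightarrow> norm (F z) \<le> K * (1 + norm z) ^ D * exp (k z)"
    using pgrowE[OF assms(1)] by blast
  show ?thesis
  proof (rule pgrowI[where K = "K * 2 ^ D * exp H" and D = D], rule loc)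
    fix z w :: complex assume w: "norm (w - z) \<le> 1"
    have "1 + norm w \<le> 2 * (1 + norm z)"
      using w norm_triangle_ineq[of z "w - z"] norm_ge_zero[of z] by (simp del: norm_ge_zero)
    then have "(1 + norm w) ^ D \<le> (2 * (1 + norm z)) ^ D"
      by (intro power_mono) auto
    then have "K * (1 + norm w) ^ D * exp (k w) \<le> K * (2 * (1 + norm z)) ^ D * exp (k z + H)"
      using K(1) lip[OF w] by (intro mult_mono) auto
    then have "norm (F w) \<le> K * (2 * (1 + norm z)) ^ D * exp (k z + H)"
      using K(2)[of w] by simp
    then show "norm (F w) \<le> K * 2 ^ D * exp H * (1 + norm z) ^ D * exp (k z)"
      by (simp only: exp_add power_mult_distrib mult_ac)
  qed
qed

lemma pgrow_shift:
  assumes "pgrow UNIV k F" and "\<And>z w. norm (w - z) \<le> 1 \<Longrightarrow> k w \<le> k z + H"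
  shows "pgrow UNIV k (\<lambda>z. F (z + 1))"
  by (rule pgrow_local[OF assms]) auto

lemma pgrow_deriv:
  assumes "pgrow UNIV k F" and "\<And>z w. norm (w - z) \<le> 1 \<Longrightarrow> k w \<le> k z + H"
    and hol: "F holomorphic_on UNIV"
  shows "pgrow UNIV k (deriv F)"
proof (rule pgrow_local[OF assms(1,2)])
  fix z M assume M: "\<And>w. norm (w - z) \<le> 1 \<Longrightarrow> norm (F w) \<le> M"
  have "norm ((deriv ^^ 1) F z) \<le> fact 1 * M / 1 ^ 1"
  proof (rule Cauchy_inequality)
    show "F holomorphic_on ball z 1" using hol holomorphic_on_subset by blast
    show "continuous_on (cball z 1) F"
      using hol holomorphic_on_imp_continuous_on continuous_on_subset by blast
  qed (use M in \<open>auto simp: norm_minus_commute\<close>)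
  then show "norm (deriv F z) \<le> M" by simp
qed

lemma pgrow_imp_poly:
  assumes hol: "F holomorphic_on UNIV" and "pgrow UNIV (\<lambda>_. 0) F"
  shows "\<exists>P. \<forall>z. F z = poly P z"
proof -
  obtain K D where K: "1 \<le> K" "\<And>z. z \<in> UNIV \<Longrightarrow> norm (F z) \<le> K * (1 + norm z) ^ D * exp 0"
    using pgrowE[OF assms(2)] by blast
  have "F z = (\<Sum>k\<le>D. (deriv ^^ k) F 0 / fact k * z ^ k)" for z
  proof (rule Liouville_polynomial[OF hol])
    fix z :: complex assume "1 \<le> norm z"
    then have "(1 + norm z) ^ D \<le> (2 * norm z) ^ D" by (intro power_mono) auto
    then have "K * (1 + norm z) ^ D \<le> K * (2 * norm z) ^ D" using K(1) by simp
    then show "norm (F z) \<le> K * 2 ^ D * norm z ^ D"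
      using K(2)[of z] by (simp add: power_mult_distrib mult_ac)
  qed
  then have "F z = poly (\<Sum>k\<le>D. monom ((deriv ^^ k) F 0 / fact k) k) z" for z
    by (simp add: poly_sum poly_monom)
  then show ?thesis by blast
qed

text \<open>Along the ray \<open>of_real s / a\<close> the polynomial tends to 0, whereas a
  nonconstant one would tend to infinity.\<close>

lemma poly_decaying_eq_0:
  assumes a: "a \<noteq> 0" and d: "0 < d"
    and P: "pgrow {z. 0 \<le> Re (a * z)} (\<lambda>z. - d * Re (a * z)) (poly P)"
  shows "P = 0"
proof -
  obtain K D where K: "1 \<le> K" "\<And>z. z \<in> {z. 0 \<le> Re (a * z)} \<Longrightarrow>
      norm (poly P z) \<le> K * (1 + norm z) ^ D * exp (- d * Re (a * z))"
    using pgrowE[OF P] by blast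
  define Q where "Q = pcompose P [:0, 1 / a:]"
  have Q: "norm (poly Q (of_real s)) \<le> K * (1 + s / norm a) ^ D * exp (- d * s)" if "0 \<le> s" for s
  proof -
    have e: "a * (of_real s / a) = of_real s" using a by simp
    have "of_real s / a \<in> {z. 0 \<le> Re (a * z)}"
      by (simp only: mem_Collect_eq e Re_complex_of_real that)
    from K(2)[OF this, unfolded e] show ?thesis
      using that by (simp add: Q_def poly_pcompose norm_divide)
  qed
  have "((\<lambda>s. K * (1 + s / norm a) ^ D * exp (- d * s)) \<longlongrightarrow> 0) at_top"
  proof -
    have "0 < 1 / norm a" using a by simp
    then have "((\<lambda>s. K * (1 + s * (1 / norm a)) ^ D * exp (- d * s)) \<longlongrightarrow> 0) at_top"
      using d by real_asymp
    then show ?thesis by simp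
  qed
  moreover have "eventually (\<lambda>s. norm (poly Q (of_real s)) \<le> K * (1 + s / norm a) ^ D * exp (- d * s)) at_top"
    using eventually_ge_at_top[of 0] by eventually_elim (rule Q)
  ultimately have lim: "((\<lambda>s. poly Q (of_real s)) \<longlongrightarrow> 0) at_top"
    by (rule Lim_null_comparison[rotated])
  have "degree Q = 0"
  proof (rule ccontr)
    assume "degree Q \<noteq> 0"
    then have "filterlim (\<lambda>s. poly Q (of_real s)) at_infinity (at_top :: real filter)"
      by (intro filterlim_compose[OF filterlim_poly_at_infinity] filterlim_of_real_at_infinity) auto
    with lim show False using not_tendsto_and_filterlim_at_infinity[of "at_top :: real filter"] by auto
  qed
  then obtain c where c: "Q = [:c:]" by (rule degree_eq_zeroE)
  have "c = 0" using lim tendsto_unique[of "at_top :: real filter"] by (auto simp: c tendsto_const_iff)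
  then show ?thesis using pcompose_eq_0[of P "[:0, 1 / a:]"] a by (simp add: c Q_def[symmetric])
qed

section \<open>Exponential polynomials\<close>

lemma deriv_proportional_imp_exp:
  assumes hol: "f holomorphic_on UNIV" and ode: "\<And>z. deriv f z = b * f z"
  shows "\<exists>c. \<forall>z. f z = c * exp (b * z)"
proof -
  have "((\<lambda>z. f z * exp (- b * z)) has_field_derivative 0) (at z)" for z
    using holomorphic_derivI[OF hol, of z] ode[of z]
    by (auto intro!: derivative_eq_intros simp: algebra_simps)
  then obtain c where "\<And>z. f z * exp (- b * z) = c"
    using has_field_derivative_zero_constant[of UNIV "\<lambda>z. f z * exp (- b * z)"] by auto
  then have "f z = c * exp (b * z)" for z
    by (metis (no_types) exp_minus_inverse mult.assoc mult.right_neutral mult_minus_left mult.commute)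
  then show ?thesis by blast
qed

text \<open>Induction on the degree: \<open>- r / a\<close> solves the equation up to the remainder
  \<open>pderiv r / a\<close>, which has lower degree.\<close>

lemma poly_first_order_ode_solvable:
  fixes a :: complex
  assumes a: "a \<noteq> 0"
  shows "\<exists>g. pderiv g - smult a g = r"
proof (induction "degree r" arbitrary: r rule: less_induct)
  case less
  show ?case
  proof (cases "degree r = 0")
    case True
    then obtain c where "r = [:c:]" by (rule degree_eq_zeroE)
    then show ?thesis using a by (intro exI[of _ "[:- c / a:]"]) (simp add: pderiv_pCons)
  next
    case False
    then have "degree (smult (1/a) (pderiv r)) < degree r" using a by (simp add: degree_pderiv)
    from less[OF this] obtain g where "pderiv g - smult a g = smult (1/a) (pderiv r)" by blast
    then show ?thesis using a
      by (intro exI[of _ "g - smult (1/a) r"]) (simp add: pderiv_diff pderiv_smult algebra_simps smult_diff_right)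
  qed
qed

text \<open>Multiply by \<open>exp (- l0 * z)\<close> and differentiate until \<open>P l0\<close>
  disappears. The other coefficients undergo powers of \<open>T (l - l0)\<close>, which is injective
  because it multiplies the leading coefficient by \<open>l - l0\<close>; induction on the set of
  exponents finishes.\<close>

lemma exp_poly_independent_set:
  assumes "finite S" "\<And>z. (\<Sum>l\<in>S. poly (P l) z * exp (l * z)) = 0" "l \<in> S"
  shows "P l = (0 :: complex poly)"
  using assms
proof (induction S arbitrary: P l rule: finite_induct)
  case empty
  then show ?case by simp
next
  case (insert l0 S)
  define T :: "complex \<Rightarrow> complex poly \<Rightarrow> complex poly" where "T m p = pderiv p + smult m p" for m p
  have T0: "p = 0" if "T m p = 0" "m \<noteq> 0" for m p
  proof (rule ccontr)
    assume "p \<noteq> 0"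
    have "coeff (pderiv p) (degree p) = 0"
      by (simp add: coeff_pderiv coeff_eq_0)
    then have "m * lead_coeff p = 0" using arg_cong[OF that(1), of "\<lambda>q. coeff q (degree p)"]
      by (simp add: T_def)
    with \<open>p \<noteq> 0\<close> that(2) show False by simp
  qed
  have Tn0: "p = 0" if "(T m ^^ n) p = 0" "m \<noteq> 0" for m p n
    using that(1) by (induction n) (auto dest: T0[OF _ that(2)])
  have shifted: "poly ((pderiv ^^ n) (P l0)) z
      + (\<Sum>l\<in>S. poly ((T (l - l0) ^^ n) (P l)) z * exp ((l - l0) * z)) = 0" for n z
  proof (induction n arbitrary: z)
    case 0
    have "(\<Sum>l\<in>insert l0 S. poly (P l) z * exp (l * z)) * exp (- l0 * z) = 0"
      by (simp add: insert.prems(1))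
    then have "(\<Sum>l\<in>insert l0 S. poly (P l) z * exp ((l - l0) * z)) = 0"
      unfolding sum_distrib_right by (simp add: mult.assoc left_diff_distrib flip: exp_add)
    then show ?case using insert.hyps by simp
  next
    case (Suc n)
    let ?F = "\<lambda>z. poly ((pderiv ^^ n) (P l0)) z
      + (\<Sum>l\<in>S. poly ((T (l - l0) ^^ n) (P l)) z * exp ((l - l0) * z))"
    have "((\<lambda>z. poly p z * exp (m * z)) has_field_derivative (poly (T m p) z * exp (m * z))) (at z)" for m p
      by (auto intro!: derivative_eq_intros simp: T_def algebra_simps)
    then have "(?F has_field_derivative (poly ((pderiv ^^ Suc n) (P l0)) z
      + (\<Sum>l\<in>S. poly ((T (l - l0) ^^ Suc n) (P l)) z * exp ((l - l0) * z)))) (at z)"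
      unfolding funpow.simps o_apply by (intro DERIV_add DERIV_sum poly_DERIV)
    moreover have "?F = (\<lambda>z. 0)" using Suc by auto
    ultimately have "((\<lambda>z. 0) has_field_derivative (poly ((pderiv ^^ Suc n) (P l0)) z
      + (\<Sum>l\<in>S. poly ((T (l - l0) ^^ Suc n) (P l)) z * exp ((l - l0) * z)))) (at z)"
      by (simp only:)
    then show ?case by (rule DERIV_unique[OF _ DERIV_const])
  qed
  define n where "n = Suc (degree (P l0))"
  have "(pderiv ^^ n) (P l0) = 0"
    by (rule poly_eqI) (simp only: coeff_higher_pderiv, simp add: n_def coeff_eq_0)
  then have "(\<Sum>l\<in>S. poly ((T (l - l0) ^^ n) (P l)) z * exp ((l - l0) * z)) * exp (l0 * z) = 0" for z
    using shifted[of n z] by simp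
  then have "(\<Sum>l\<in>S. poly ((T (l - l0) ^^ n) (P l)) z * exp (l * z)) = 0" for z
    unfolding sum_distrib_right by (simp add: mult.assoc left_diff_distrib flip: exp_add)
  then have "(T (l - l0) ^^ n) (P l) = 0" if "l \<in> S" for l
    using insert.IH[of "\<lambda>l. (T (l - l0) ^^ n) (P l)"] that by blast
  then have PS: "P l = 0" if "l \<in> S" for l
    using Tn0[where m = "l - l0" and n = n and p = "P l"] that insert.hyps by auto
  have "poly (P l0) z * exp (l0 * z) = 0" for z
    using insert.prems(1)[of z] insert.hyps PS by simp
  then have "P l0 = 0" by (simp flip: poly_all_0_iff_0)
  then show ?case using insert.prems PS by blast
qed

lemma exp_poly_independent:
  assumes "distinct (map fst xs)" "\<And>z. (\<Sum>(l, p)\<leftarrow>xs. poly p z * exp (l * z)) = 0"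
  shows "\<forall>(l, p)\<in>set xs. p = (0 :: complex poly)"
proof -
  define P where "P l = the (map_of xs l)" for l
  have P: "P l = p" if "(l, p) \<in> set xs" for l p
    using assms(1) that by (simp add: P_def)
  have "(\<Sum>l\<in>set (map fst xs). poly (P l) z * exp (l * z)) = 0" for z
  proof -
    have "(\<Sum>l\<in>set (map fst xs). poly (P l) z * exp (l * z))
        = (\<Sum>l\<leftarrow>map fst xs. poly (P l) z * exp (l * z))"
      by (rule sum_list_distinct_conv_sum_set[OF assms(1), symmetric])
    also have "\<dots> = (\<Sum>(l, p)\<leftarrow>xs. poly p z * exp (l * z))"
      unfolding map_map by (intro arg_cong[of _ _ sum_list] map_cong) (auto simp: P)
    finally show ?thesis using assms(2) by simp
  qed
  then have "P l = 0" if "l \<in> set (map fst xs)" for l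
    using exp_poly_independent_set[OF finite_set _ that] by blast
  then show ?thesis using P by fastforce
qed

text \<open>For real multiples of \<open>a\<close>, distinctness of the exponents becomes a
  comparison of real numbers; all later comparisons of coefficients have this form.\<close>

lemma exp_poly_independent_real:
  assumes "a \<noteq> 0" "distinct (map fst xs)"
    "\<And>z. (\<Sum>(s, p)\<leftarrow>xs. poly p z * exp (of_real s * a * z)) = 0"
  shows "\<forall>(s :: real, p)\<in>set xs. p = (0 :: complex poly)"
proof -
  let ?ys = "map (\<lambda>(s, p). (of_real s * a, p)) xs"
  have "map fst ?ys = map (\<lambda>s. of_real s * a) (map fst xs)"
    by (simp add: case_prod_beta)
  moreover have "inj_on (\<lambda>s::real. of_real s * a) (set (map fst xs))"
    using assms(1) by (intro inj_onI) simp
  ultimately have "distinct (map fst ?ys)"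
    using assms(2) distinct_map by metis
  moreover have "(\<Sum>(l, p)\<leftarrow>?ys. poly p z * exp (l * z)) = 0" for z
    using assms(3)[of z] by (simp add: o_def split_def)
  ultimately have "\<forall>(l, p)\<in>set ?ys. p = 0"
    by (rule exp_poly_independent)
  then show ?thesis by auto
qed

section \<open>The cubic difference equation\<close>

text \<open>The right-hand side of the conclusion is a supersolution: if \<^term>\<open>f\<close> exceeds it by a
  factor \<open>l > 1\<close> at one point, then by a factor \<open>l ^ 3\<close> at the next translate.\<close>
lemma pgrow_difference_equation:
  fixes h :: "complex \<Rightarrow> real"
  assumes hol: "f holomorphic_on UNIV" and ho: "hyper_order f < 1"
    and eq: "\<And>z. f z ^ 3 + poly q z * (f (z + 1) - f z) = R z"
    and R: "\<And>z. norm (R z) \<le> P * exp (h z)"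
    and h0: "\<And>z. 0 \<le> h z" and h1: "\<And>z. h (z + 1) \<le> h z + H"
  shows "pgrow UNIV (\<lambda>z. h z / 3) f"
proof -
  obtain Q d where Q: "1 \<le> Q" "\<And>z. z \<in> UNIV \<Longrightarrow> norm (poly q z) \<le> Q * (1 + norm z) ^ d * exp 0"
    using pgrowE[OF pgrow_poly] by blast
  have P0: "0 \<le> P"
    using order_trans[OF norm_ge_zero R] by (simp add: zero_le_mult_iff)
  \<comment> \<open>\<open>M\<close> collects what is lost in bounding
    \<open>2 * Q * w * B (z + 1)\<close> by data at \<open>z\<close>: the weight grows by at most
    \<open>2 ^ d\<close> and the exponential by \<open>exp (H / 3)\<close>. \<open>K\<close> is then
    so large that its powers dominate all constants.\<close>
  define M where "M = 2 * Q * 2 ^ d * exp (H / 3)"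
  have M0: "0 \<le> M" unfolding M_def using Q(1) by simp
  define K where "K = 1 + 4 * P + 4 * Q + M"
  have K1: "1 \<le> K" using P0 Q(1) M0 by (simp add: K_def)
  have K3: "4 * P \<le> K ^ 3" using self_le_power[OF K1, of 3] P0 Q(1) M0 by (simp add: K_def)
  have K2: "4 * Q \<le> K ^ 2" "M \<le> K ^ 2"
    using self_le_power[OF K1, of 2] P0 Q(1) M0 by (simp_all add: K_def)
  define B where "B z = K * (1 + norm z) ^ d * exp (h z / 3)" for z
  have B1: "1 \<le> B z" for z
  proof -
    have "1 \<le> exp (h z / 3)" using h0[of z] by simp
    then show ?thesis unfolding B_def using K1 by (intro mult_ge1_I) auto
  qed
  have step: "l ^ 3 * B (z + 1) \<le> norm (f (z + 1))" if l: "1 \<le> l" "l * B z \<le> norm (f z)" for l z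
  proof -
    define F w e G where "F = norm (f z)" and "w = (1 + norm z) ^ d" and "e = exp (h z / 3)"
      and "G = norm (f (z + 1))"
    have w: "1 \<le> w" unfolding w_def by simp
    have e: "1 \<le> e" unfolding e_def using h0[of z] by simp
    have e3: "exp (h z) = e ^ 3" unfolding e_def using exp_of_nat_mult[of 3 "h z / 3"] by simp
    have B: "B z = K * w * e" by (simp add: B_def w_def e_def)
    have "1 * B z \<le> l * B z" using l(1) B1[of z] by (intro mult_right_mono) auto
    then have FB: "K * w * e \<le> F" using l(2) by (simp add: B F_def)
    have F0: "0 < F" using FB B1[of z] by (simp add: B)
    have "4 * P * e ^ 3 \<le> K ^ 3 * (w ^ 3 * e ^ 3)"
      using K3 K1 e w P0 by (intro mult_mono) auto
    also have "\<dots> \<le> F ^ 3"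
      using power_mono[OF FB, of 3] K1 w e by (simp add: power_mult_distrib mult.assoc)
    finally have a1: "4 * (P * e ^ 3) \<le> F ^ 3" by simp
    have "4 * Q * w \<le> K ^ 2 * (w ^ 2 * e ^ 2)"
    proof (intro mult_mono K2)
      have "w * 1 \<le> w ^ 2 * e ^ 2" using w e by (intro mult_mono self_le_power) auto
      then show "w \<le> w ^ 2 * e ^ 2" by simp
    qed (use w in auto)
    also have "\<dots> \<le> F ^ 2"
      using power_mono[OF FB, of 2] K1 w e by (simp add: power_mult_distrib mult.assoc)
    finally have "4 * Q * w * F \<le> F ^ 2 * F" using F0 by (intro mult_right_mono) auto
    then have a2: "4 * (Q * w * F) \<le> F ^ 3" by (simp add: power2_eq_square power3_eq_cube)
    have "f z ^ 3 = R z - poly q z * (f (z + 1) - f z)" using eq[of z] by (simp add: algebra_simps)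
    then have "F ^ 3 \<le> norm (R z) + norm (poly q z) * norm (f (z + 1) - f z)"
      unfolding F_def norm_power[symmetric] norm_mult[symmetric] by (simp add: norm_triangle_ineq4)
    also have "\<dots> \<le> P * e ^ 3 + (Q * w) * (G + F)"
      unfolding F_def G_def e3[symmetric] using R[of z] Q(2)[of z] Q(1) w
      by (intro add_mono mult_mono norm_triangle_ineq4) (auto simp: w_def)
    \<comment> \<open>The terms \<open>P * e ^ 3\<close> and \<open>Q * w * F\<close> each take at
      most a quarter of \<open>F ^ 3\<close>, so at least half of it must come from
      \<open>f (z + 1)\<close>.\<close>
    finally have a3: "F ^ 3 \<le> 2 * (Q * w * G)" using a1 a2 by (simp add: algebra_simps)
    have "B (z + 1) \<le> K * (2 ^ d * w) * (e * exp (H / 3))"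
    proof -
      have "1 + norm (z + 1) \<le> 2 * (1 + norm z)"
        using norm_triangle_ineq[of z 1] norm_ge_zero[of z] by (simp del: norm_ge_zero)
      then have "(1 + norm (z + 1)) ^ d \<le> (2 * (1 + norm z)) ^ d" by (intro power_mono) auto
      then have p1: "(1 + norm (z + 1)) ^ d \<le> 2 ^ d * w"
        by (simp only: power_mult_distrib w_def)
      have "exp (h (z + 1) / 3) \<le> exp (h z / 3 + H / 3)" using h1[of z] by simp
      then have "exp (h (z + 1) / 3) \<le> e * exp (H / 3)" by (simp add: exp_add e_def)
      then show ?thesis unfolding B_def using p1 K1 w by (intro mult_mono) auto
    qed
    then have "2 * (Q * w) * B (z + 1) \<le> 2 * (Q * w) * (K * (2 ^ d * w) * (e * exp (H / 3)))"
      using Q(1) w by (intro mult_left_mono) auto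
    also have "\<dots> = M * (K * w ^ 2 * e)" by (simp add: M_def power2_eq_square)
    also have "\<dots> \<le> K ^ 2 * (K * w ^ 3 * e ^ 3)"
      using K2(2) K1 w e M0
      by (intro mult_mono power_increasing self_le_power) auto
    also have "\<dots> = B z ^ 3" by (simp add: B power_mult_distrib power2_eq_square power3_eq_cube)
    finally have "l ^ 3 * (2 * (Q * w) * B (z + 1)) \<le> l ^ 3 * B z ^ 3"
      using l(1) by (intro mult_left_mono) auto
    also have "\<dots> \<le> F ^ 3"
      unfolding power_mult_distrib[symmetric] F_def using l B1[of z] by (intro power_mono) auto
    also note a3
    finally have "(2 * (Q * w)) * (l ^ 3 * B (z + 1)) \<le> (2 * (Q * w)) * G" by (simp add: mult_ac)
    then show ?thesis using Q(1) w by (simp add: G_def)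
  qed
  have "norm (f z) \<le> B z" for z
  proof (rule ccontr)
    assume "\<not> norm (f z) \<le> B z"
    define l where "l = norm (f z) / B z"
    have l: "1 < l" using \<open>\<not> norm (f z) \<le> B z\<close> B1[of z] by (simp add: l_def)
    have *: "l ^ (3 ^ n) * B (z + of_nat n) \<le> norm (f (z + of_nat n))" for n
    proof (induction n)
      case 0
      show ?case using B1[of z] by (simp add: l_def)
    next
      case (Suc n)
      have "(l ^ (3 ^ n)) ^ 3 * B (z + of_nat n + 1) \<le> norm (f (z + of_nat n + 1))"
        using l Suc by (intro step) auto
      moreover have "(l ^ (3 ^ n)) ^ 3 = l ^ (3 ^ Suc n)"
        by (simp add: power_mult[symmetric] mult.commute)
      ultimately show ?case by (simp add: add_ac)
    qed
    obtain n where "norm (f (z + of_nat n)) < l ^ (3 ^ n)"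
      using translates_below_triple_powers[OF hol ho l] by blast
    moreover have "l ^ (3 ^ n) * 1 \<le> l ^ (3 ^ n) * B (z + of_nat n)"
      using l by (intro mult_left_mono B1) auto
    ultimately show False using *[of n] by simp
  qed
  then show ?thesis unfolding B_def by (rule pgrowI)
qed

section \<open>Growth bounds for a solution, and reality of the ratio of the exponents\<close>

locale cubic_difference_equation =
  fixes q :: "complex poly" and p1 p2 a b :: complex and f :: "complex \<Rightarrow> complex"
  assumes p1: "p1 \<noteq> 0" and p2: "p2 \<noteq> 0" and a: "a \<noteq> 0" and b: "b \<noteq> 0" and ab: "a \<noteq> b"
    and hol: "f holomorphic_on UNIV"
    and ho: "hyper_order f < 1"
    and eq: "\<And>z. (f z)^3 + poly q z * (f (z + 1) - f z) = p1 * exp (a * z) + p2 * exp (b * z)"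
begin

text \<open>The exponential rate of \<open>R\<close>, cut off at 0 because the supersolution
  argument needs a nonnegative exponent.\<close>

definition h :: "complex \<Rightarrow> real" where "h z = max 0 (max (Re (a * z)) (Re (b * z)))"
definition R :: "complex \<Rightarrow> complex" where "R z = p1 * exp (a * z) + p2 * exp (b * z)"
definition C :: "complex \<Rightarrow> complex" where "C z = poly q z * (f (z + 1) - f z)"

lemma h_Lipschitz:
  assumes "norm (w - z) \<le> 1"
  shows "h w \<le> h z + (norm a + norm b)"
proof -
  have *: "Re (c * w) \<le> Re (c * z) + norm c" for c
  proof -
    have "Re (c * w) - Re (c * z) \<le> norm (c * (w - z))"
      using complex_Re_le_cmod[of "c * (w - z)"] by (simp add: algebra_simps)
    also have "\<dots> \<le> norm c * 1" unfolding norm_mult using assms by (intro mult_left_mono) auto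
    finally show ?thesis by simp
  qed
  show ?thesis using *[of a] *[of b] norm_ge_zero[of a] norm_ge_zero[of b]
    unfolding h_def max_def by (auto simp del: norm_ge_zero times_complex.sel)
qed

lemma R_le: "norm (R z) \<le> (norm p1 + norm p2) * exp (h z)"
proof -
  have "norm (R z) \<le> norm p1 * exp (Re (a * z)) + norm p2 * exp (Re (b * z))"
    unfolding R_def by (rule norm_triangle_le) (simp add: norm_mult)
  also have "\<dots> \<le> norm p1 * exp (h z) + norm p2 * exp (h z)"
    by (intro add_mono mult_left_mono) (auto simp: h_def simp del: times_complex.sel)
  finally show ?thesis by (simp add: algebra_simps)
qed

lemma f_grow: "pgrow UNIV (\<lambda>z. h z / 3) f"
proof (rule pgrow_difference_equation[OF hol ho])
  show "f z ^ 3 + poly q z * (f (z + 1) - f z) = R z" for z using eq by (simp add: R_def)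
  show "h (z + 1) \<le> h z + (norm a + norm b)" for z by (rule h_Lipschitz) simp
qed (rule R_le, simp add: h_def)

lemma h3_Lipschitz: "norm (w - z) \<le> 1 \<Longrightarrow> h w / 3 \<le> h z / 3 + (norm a + norm b) / 3"
  using h_Lipschitz[of w z] by (simp add: field_simps)

lemma f'_grow: "pgrow UNIV (\<lambda>z. h z / 3) (deriv f)"
  by (rule pgrow_deriv[OF f_grow h3_Lipschitz hol])

lemma C_grow: "pgrow UNIV (\<lambda>z. h z / 3) C"
  unfolding C_def
  using pgrow_mult[OF pgrow_poly pgrow_diff[OF pgrow_shift[OF f_grow h3_Lipschitz] f_grow]] by simp

lemma holomorphic_C: "C holomorphic_on UNIV"
  unfolding C_def
  by (intro holomorphic_intros hol holomorphic_on_compose_gen[OF _ hol, unfolded o_def]) auto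

lemma C'_grow: "pgrow UNIV (\<lambda>z. h z / 3) (deriv C)"
  by (rule pgrow_deriv[OF C_grow h3_Lipschitz holomorphic_C])

lemma f_cubed: "f z ^ 3 = R z - C z"
  using eq[of z] by (simp add: R_def C_def algebra_simps)

definition R' :: "complex \<Rightarrow> complex" where "R' z = a * p1 * exp (a * z) + b * p2 * exp (b * z)"

lemma R_deriv: "(R has_field_derivative R' z) (at z)"
  unfolding R_def R'_def by (auto intro!: derivative_eq_intros simp: algebra_simps)

lemma f_cubed_deriv: "3 * f z ^ 2 * deriv f z = R' z - deriv C z"
proof -
  have "((\<lambda>z. f z ^ 3) has_field_derivative 3 * f z ^ 2 * deriv f z) (at z)"
    using holomorphic_derivI[OF hol, of z] by (auto intro!: derivative_eq_intros simp: algebra_simps power2_eq_square)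
  moreover have "((\<lambda>z. f z ^ 3) has_field_derivative R' z - deriv C z) (at z)"
    unfolding f_cubed using R_deriv holomorphic_derivI[OF holomorphic_C, of z]
    by (intro DERIV_diff) auto
  ultimately show ?thesis by (rule DERIV_unique)
qed

text \<open>At a zero of \<^term>\<open>R\<close> the cube \<open>f ^ 3\<close> is only as large as \<^term>\<open>C\<close>, which makes \<open>3 f\<^sup>2 f'\<close>
  much smaller than \<^term>\<open>R'\<close>. If \<^term>\<open>a\<close> and \<^term>\<open>b\<close> were independent over the reals, then
  \<^term>\<open>R\<close> would have zeros where \<^term>\<open>R'\<close> is exponentially large.\<close>
lemma collinear: "\<exists>t::real. b = of_real t * a"
proof (rule ccontr)
  assume nc: "\<not> (\<exists>t::real. b = of_real t * a)"
  \<comment> \<open>\<open>w0\<close> is a period of \<open>exp ((a - b) * z)\<close>, so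
    translation by it preserves the zeros of \<open>R\<close>. Since \<open>b\<close> is no real
    multiple of \<open>a\<close>, it also changes \<open>Re (a * z)\<close>, and with the right sign
    it leads to where \<open>exp (a * z)\<close> is large.\<close>
  define w0 where "w0 = 2 * of_real pi * \<i> / (a - b)"
  have "Re (a * w0) \<noteq> 0"
  proof
    assume "Re (a * w0) = 0"
    have "a * w0 = of_real (2 * pi) * \<i> * (a / (a - b))" by (simp add: w0_def)
    moreover have "Re (of_real (2 * pi) * \<i> * u) = - 2 * pi * Im u" for u by simp
    ultimately have "Re (a * w0) = - 2 * pi * Im (a / (a - b))" by (simp only:)
    with \<open>Re (a * w0) = 0\<close> have "Im (a / (a - b)) = 0" by simp
    then obtain s where s: "a / (a - b) = of_real s"
      by (metis complex_is_Real_iff Reals_cases)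
    then have "s \<noteq> 0" using a ab by auto
    have "b = of_real (1 - 1 / s) * a"
      using s ab \<open>s \<noteq> 0\<close> by (simp add: field_simps)
    then show False using nc by blast
  qed
  define w where "w = (if Re (a * w0) > 0 then w0 else - w0)"
  define d where "d = Re (a * w)"
  have d: "0 < d" using \<open>Re (a * w0) \<noteq> 0\<close> by (auto simp: d_def w_def simp del: times_complex.sel)
  have "exp ((a - b) * w0) = 1"
    using ab by (simp add: w0_def)
  then have ew: "exp ((a - b) * w) = 1" by (simp add: w_def exp_minus)
  define z0 where "z0 = Ln (- p2 / p1) / (a - b)"
  have ez0: "exp ((a - b) * z0) = - p2 / p1" using ab p1 p2 by (simp add: z0_def)
  define z where "z n = z0 + of_nat n * w" for n
  define Z where "Z = {z. R z = 0 \<and> 0 \<le> Re (a * z)}"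
  have Rz: "R (z n) = 0" for n
  proof -
    have "exp ((a - b) * z n) = - p2 / p1"
      using ez0 ew exp_of_nat_mult[of n "(a - b) * w"]
      by (simp add: z_def ring_distribs exp_add mult_ac)
    moreover have "R (z n) = exp (b * z n) * (p1 * exp ((a - b) * z n) + p2)"
      by (simp add: R_def ring_distribs flip: exp_add)
    ultimately show ?thesis using p1 by simp
  qed
  have Rez: "Re (a * z n) = Re (a * z0) + real n * d" for n
    by (simp add: z_def d_def algebra_simps)
  define c where "c = \<bar>ln (norm p1 / norm p2)\<bar>"
  \<comment> \<open>At a zero of \<open>R\<close> its two terms have equal modulus, so
    \<open>Re (b * z)\<close> and \<open>Re (a * z)\<close> differ by a constant.\<close>
  have hZ: "h z \<le> Re (a * z) + c" if "z \<in> Z" for z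
  proof -
    have "norm (p1 * exp (a * z)) = norm (p2 * exp (b * z))"
      using that by (simp add: Z_def R_def eq_neg_iff_add_eq_0[symmetric])
    then have "exp (Re (b * z)) = exp (Re (a * z)) * (norm p1 / norm p2)"
      using p2 by (simp add: norm_mult field_simps)
    also have "\<dots> = exp (Re (a * z) + ln (norm p1 / norm p2))"
      using p1 p2 by (simp add: exp_add)
    finally have "Re (b * z) = Re (a * z) + ln (norm p1 / norm p2)" by simp
    then show ?thesis using that unfolding h_def c_def Z_def by (simp del: times_complex.sel)
  qed
  have "pgrow Z (\<lambda>z. h z / 3) (\<lambda>z. f z ^ 3)"
    by (rule pgrow_mono[OF C_grow, where c = 0]) (auto simp: f_cubed Z_def)
  then have fZ: "pgrow Z (\<lambda>z. h z / 3 / 3) f" by (rule pgrow_cube_root)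
  \<comment> \<open>Each factor \<open>f\<close> contributes \<open>h / 9\<close> and the derivative
    \<open>h / 3\<close>; the total 5/9 is less than 1, which is the source of the
    contradiction.\<close>
  have "pgrow Z (\<lambda>z. h z / 3 / 3 + h z / 3 / 3 + h z / 3) (\<lambda>z. f z * f z * deriv f z)"
    using f'_grow by (intro pgrow_mult fZ) (rule pgrow_weaken, auto)
  then have "pgrow Z (\<lambda>z. 5 / 9 * h z) (\<lambda>z. 3 * (f z * f z * deriv f z))"
    by (intro pgrow_cmult) (rule pgrow_weaken, auto)
  moreover have "pgrow Z (\<lambda>z. 5 / 9 * h z) (deriv C)"
    using C'_grow by (rule pgrow_weaken) (auto simp: h_def)
  ultimately have "pgrow Z (\<lambda>z. 5 / 9 * h z) (\<lambda>z. 3 * (f z * f z * deriv f z) + deriv C z)"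
    by (rule pgrow_add)
  then have R'Z: "pgrow Z (\<lambda>z. 5 / 9 * h z) R'"
    by (rule pgrow_mono[where c = 0]) (use f_cubed_deriv in \<open>auto simp: power2_eq_square mult.assoc\<close>)
  have "R' z = (a - b) * p1 * exp (a * z)" if "z \<in> Z" for z
  proof -
    have "p2 * exp (b * z) = - (p1 * exp (a * z))"
      using that by (simp add: Z_def R_def eq_neg_iff_add_eq_0 add.commute)
    then show ?thesis unfolding R'_def mult.assoc by (simp only:) (simp add: algebra_simps)
  qed
  moreover have "5 / 9 * h z \<le> 5 / 9 * Re (a * z) + 5 / 9 * c" if "z \<in> Z" for z
    using hZ[OF that] by linarith
  then have "pgrow Z (\<lambda>z. 5 / 9 * Re (a * z)) (\<lambda>z. (1 / ((a - b) * p1)) * R' z)"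
    by (intro pgrow_cmult pgrow_mono[OF R'Z, where c = "5 / 9 * c"]) auto
  ultimately have "pgrow Z (\<lambda>z. 5 / 9 * Re (a * z)) (\<lambda>z. exp (a * z))"
    by (intro pgrow_mono[where c = 0 and k' = "\<lambda>z. 5 / 9 * Re (a * z)"]) (use ab p1 in \<open>auto simp del: times_complex.sel\<close>)
  then obtain K D where K: "1 \<le> K"
      "\<And>z. z \<in> Z \<Longrightarrow> norm (exp (a * z)) \<le> K * (1 + norm z) ^ D * exp (5 / 9 * Re (a * z))"
    using pgrowE by blast
  define x0 r s where "x0 = Re (a * z0)" and "r = norm z0" and "s = norm w"
  have ev: "eventually (\<lambda>n. K * (1 + (r + real n * s)) ^ D * exp (5 / 9 * (x0 + real n * d)) < exp (x0 + real n * d)) sequentially"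
  proof -
    have "0 < s" using d by (auto simp: s_def d_def)
    moreover have "0 < K" using K(1) by simp
    ultimately show ?thesis using d by real_asymp
  qed
  moreover have "eventually (\<lambda>n. 0 \<le> x0 + real n * d) sequentially"
    using d by real_asymp
  ultimately have "eventually (\<lambda>n. False) sequentially"
  proof eventually_elim
    case (elim n)
    have "z n \<in> Z" using elim Rz[of n] Rez[of n] by (simp add: Z_def x0_def del: times_complex.sel)
    from K(2)[OF this] have "exp (x0 + real n * d) \<le> K * (1 + norm (z n)) ^ D * exp (5 / 9 * (x0 + real n * d))"
      unfolding norm_exp_eq_Re Rez x0_def .
    also have "\<dots> \<le> K * (1 + (r + real n * s)) ^ D * exp (5 / 9 * (x0 + real n * d))"
      using K(1) norm_triangle_ineq[of z0 "of_nat n * w"]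
      by (intro mult_right_mono mult_left_mono power_mono) (auto simp: z_def r_def s_def norm_mult)
    finally show ?case using elim by simp
  qed
  then show False by simp
qed

section \<open>Half-plane estimates when \<open>b\<close> is a real multiple of
  \<open>a\<close>\<close>

definition x :: "complex \<Rightarrow> real" where "x z = Re (a * z)"

lemma Re_b: "b = of_real t * a \<Longrightarrow> Re (b * z) = t * x z"
  by (simp add: x_def algebra_simps)

lemma h_right: "b = of_real t * a \<Longrightarrow> t < 1 \<Longrightarrow> 0 \<le> x z \<Longrightarrow> h z = x z"
  using mult_right_mono[of t 1 "x z"] unfolding h_def Re_b x_def[symmetric] by simp

lemma h_left: "b = of_real t * a \<Longrightarrow> 0 < t \<Longrightarrow> x z \<le> 0 \<Longrightarrow> h z = 0"
  using mult_nonneg_nonpos[of t "x z"] unfolding h_def Re_b x_def[symmetric] by simp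

text \<open>In \<open>p1 * exp (a * z) = f z ^ 3 + C z - p2 * exp (b * z)\<close> the last two terms
  have lower exponential order. So \<open>f z ^ 3\<close> carries the main term once
  \<open>exp (x z / 3)\<close> beats the polynomial factor in the bound for \<open>C\<close>; hence
  the alternative.\<close>

lemma f_lower_bound:
  assumes bt: "b = of_real t * a" and t: "t < 1"
  obtains c K D where "0 < c" "1 \<le> K"
    "\<And>z. 0 \<le> x z \<Longrightarrow> exp (x z / 3) \<le> K * (1 + norm z) ^ D \<or> c * exp (x z / 3) \<le> norm (f z)"
proof -
  obtain L D where L: "1 \<le> L" "\<And>z. z \<in> UNIV \<Longrightarrow> norm (C z) \<le> L * (1 + norm z) ^ D * exp (h z / 3)"
    using pgrowE[OF C_grow] by blast
  \<comment> \<open>A quarter of \<open>norm p1\<close>, so that \<open>C\<close> and the second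
    exponential may each take up \<open>s * exp (x z)\<close>. From \<open>x z = X0\<close> on, the
    second exponential stays below this.\<close>
  define s where "s = norm p1 / 4"
  have s: "0 < s" using p1 by (simp add: s_def)
  define X0 where "X0 = ln (norm p2 / s) / (1 - t)"
  define K where "K = max 1 (max (L / s) (exp (X0 / 3)))"
  define c where "c = root 3 s"
  have c: "0 < c" "c ^ 3 = s" using s by (simp_all add: c_def)
  have "c * exp (x z / 3) \<le> norm (f z)"
    if z: "0 \<le> x z" and "\<not> exp (x z / 3) \<le> K * (1 + norm z) ^ D" for z
  proof -
    define v w where "v = exp (x z / 3)" and "w = (1 + norm z) ^ D"
    have v1: "1 \<le> v" using z by (simp add: v_def)
    have v3: "exp (x z) = v ^ 3" unfolding v_def using exp_of_nat_mult[of 3 "x z / 3"] by simp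
    have w1: "1 \<le> w" by (simp add: w_def)
    have vK: "K * w < v" using that(2) by (simp add: v_def w_def)
    have "L / s * w \<le> K * w" using w1 by (intro mult_right_mono) (auto simp: K_def)
    then have "L / s * w \<le> v" using vK by simp
    then have "L * w \<le> s * v" using s by (simp add: field_simps)
    have "norm (C z) \<le> L * w * v"
      using L(2)[of z] h_right[OF bt t z] by (simp add: v_def w_def)
    also have "\<dots> \<le> s * v * v" using \<open>L * w \<le> s * v\<close> v1 by (intro mult_right_mono) auto
    also have "s * v * v \<le> s * v * v * v" using s v1 by simp
    finally have Cz: "norm (C z) \<le> s * v ^ 3"
      by (simp add: power3_eq_cube mult.assoc)
    have "exp (X0 / 3) \<le> K * w"
      using w1 mult_mono[of "exp (X0 / 3)" K 1 w] by (simp add: K_def)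
    then have "X0 / 3 < x z / 3" using vK unfolding v_def by (metis exp_less_cancel_iff le_less_trans)
    then have "ln (norm p2 / s) \<le> (1 - t) * x z" using t by (simp add: X0_def field_simps)
    then have "exp (ln (norm p2 / s)) \<le> exp (x z - t * x z)" by (simp add: algebra_simps)
    then have "norm p2 \<le> s * (v ^ 3 / exp (t * x z))"
      using p2 s by (simp add: exp_diff v3 field_simps)
    then have Bz: "norm (p2 * exp (b * z)) \<le> s * v ^ 3"
      by (simp add: norm_mult Re_b[OF bt] field_simps del: times_complex.sel)
    have "norm (p1 * exp (a * z)) = 4 * s * v ^ 3"
      by (simp add: norm_mult s_def v3[symmetric] x_def del: times_complex.sel)
    moreover have "p1 * exp (a * z) = f z ^ 3 + C z - p2 * exp (b * z)"
      by (simp add: f_cubed R_def)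
    then have "norm (p1 * exp (a * z)) \<le> norm (f z ^ 3) + norm (C z) + norm (p2 * exp (b * z))"
      by (metis norm_triangle_ineq4 norm_triangle_ineq add_right_mono order_trans)
    moreover have "0 \<le> s * v ^ 3" using s v1 by simp
    ultimately have "s * v ^ 3 \<le> norm (f z) ^ 3" using Cz Bz by (simp add: norm_power)
    then have "(c * v) ^ 3 \<le> norm (f z) ^ 3" by (simp add: power_mult_distrib c)
    then show "c * exp (x z / 3) \<le> norm (f z)"
      using c v1 by (simp add: v_def)
  qed
  moreover have "1 \<le> K" by (simp add: K_def)
  ultimately show thesis using that[OF c(1)] by blast
qed

text \<open>Where \<open>exp (x z / 3)\<close> is polynomially bounded, nothing is lost by replacing one multiple of
  \<^term>\<open>x z\<close> by another; elsewhere one can divide by \<open>f\<^sup>2\<close>.\<close>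
lemma pgrow_divide_f_squared:
  assumes bt: "b = of_real t * a" and t: "t < 1"
    and F: "pgrow {z. 0 \<le> x z} (\<lambda>z. m * x z) F"
    and f2F: "pgrow {z. 0 \<le> x z} (\<lambda>z. n * x z) (\<lambda>z. f z ^ 2 * F z)"
  shows "pgrow {z. 0 \<le> x z} (\<lambda>z. (n - 2 / 3) * x z) F"
proof -
  obtain c K D where c: "0 < c" and K: "1 \<le> K" and low: "\<And>z. 0 \<le> x z \<Longrightarrow>
      exp (x z / 3) \<le> K * (1 + norm z) ^ D \<or> c * exp (x z / 3) \<le> norm (f z)"
    using f_lower_bound[OF bt t] by blast
  define S1 where "S1 = {z. 0 \<le> x z \<and> exp (x z / 3) \<le> K * (1 + norm z) ^ D}"
  define S2 where "S2 = {z. 0 \<le> x z \<and> c * exp (x z / 3) \<le> norm (f z)}"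
  have "pgrow S1 (\<lambda>z. - r * x z) (\<lambda>z. 1)" for r
  proof -
    obtain N :: nat where N: "3 * r \<le> real N" using real_arch_simple by blast
    show ?thesis
    proof (rule pgrowI[where K = "K ^ N" and D = "D * N"])
      fix z assume z: "z \<in> S1"
      have "r * x z \<le> real N * (x z / 3)"
        using N z mult_right_mono[of "3 * r" "real N" "x z / 3"] by (simp add: S1_def)
      then have "exp (r * x z) \<le> exp (x z / 3) ^ N" by (simp flip: exp_of_nat_mult)
      also have "\<dots> \<le> (K * (1 + norm z) ^ D) ^ N" using z by (intro power_mono) (auto simp: S1_def)
      finally have "exp (r * x z) * exp (- r * x z) \<le> (K * (1 + norm z) ^ D) ^ N * exp (- r * x z)"
        by (intro mult_right_mono) auto
      then show "norm (1 :: complex) \<le> K ^ N * (1 + norm z) ^ (D * N) * exp (- r * x z)"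
        by (simp add: power_mult_distrib power_mult exp_minus)
    qed
  qed
  \<comment> \<open>The rate \<open>m - n + 2 / 3\<close> converts the crude exponent
    \<open>m\<close> into the desired \<open>n - 2 / 3\<close>.\<close>
  from pgrow_mult[OF pgrow_weaken[OF F _ order_refl] this[of "m - n + 2 / 3"]]
  have "pgrow S1 (\<lambda>z. m * x z + - (m - n + 2 / 3) * x z) F"
    by (force simp: S1_def)
  then have 1: "pgrow S1 (\<lambda>z. (n - 2 / 3) * x z) F"
    by (rule pgrow_weaken) (auto simp: algebra_simps)
  have "pgrow S2 (\<lambda>z. - (2 / 3) * x z) (\<lambda>z. 1 / f z ^ 2)"
  proof (rule pgrowI[where K = "1 / c ^ 2" and D = 0])
    fix z assume z: "z \<in> S2"
    have "exp (2 / 3 * x z) = exp (x z / 3) ^ 2"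
      using exp_of_nat_mult[of 2 "x z / 3"] by simp
    moreover have "(c * exp (x z / 3)) ^ 2 \<le> norm (f z) ^ 2"
      using z c by (intro power_mono) (auto simp: S2_def)
    moreover have "0 < norm (f z)"
    proof (rule less_le_trans)
      show "0 < c * exp (x z / 3)" using c by simp
      show "c * exp (x z / 3) \<le> norm (f z)" using z by (simp add: S2_def)
    qed
    ultimately show "norm (1 / f z ^ 2) \<le> 1 / c ^ 2 * (1 + norm z) ^ 0 * exp (- (2 / 3) * x z)"
      using c by (simp add: norm_divide norm_power exp_minus field_simps)
  qed
  from pgrow_mult[OF pgrow_weaken[OF f2F _ order_refl] this]
  have "pgrow S2 (\<lambda>z. n * x z + - (2 / 3) * x z) (\<lambda>z. f z ^ 2 * F z * (1 / f z ^ 2))"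
    by (auto simp: S2_def)
  then have 2: "pgrow S2 (\<lambda>z. (n - 2 / 3) * x z) F"
  proof (rule pgrow_mono[where c = 0])
    fix z assume z: "z \<in> S2"
    have "0 < c * exp (x z / 3)" using c by simp
    then have "f z \<noteq> 0" using z by (auto simp: S2_def simp del: zero_less_mult_iff)
    then show "norm (F z) \<le> norm (f z ^ 2 * F z * (1 / f z ^ 2))" by simp
  qed (auto simp: algebra_simps)
  have "{z. 0 \<le> x z} = S1 \<union> S2" using low by (auto simp: S1_def S2_def)
  then show ?thesis using pgrow_Un[OF 1 2] by simp
qed

text \<open>This operator annihilates \<open>exp (a * z / 3)\<close>, the expected leading term of
  \<open>f\<close> where \<open>Re (a * z)\<close> is positive.\<close>

definition u :: "complex \<Rightarrow> complex" where "u z = 3 * deriv f z - a * f z"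

lemma holomorphic_f': "deriv f holomorphic_on UNIV"
  by (rule holomorphic_deriv[OF hol open_UNIV])

lemma holomorphic_u: "u holomorphic_on UNIV"
  unfolding u_def by (intro holomorphic_intros hol holomorphic_f')

lemma u_grow: "pgrow UNIV (\<lambda>z. h z / 3) u"
  unfolding u_def by (intro pgrow_diff pgrow_cmult f_grow f'_grow)

text \<open>In \<open>f\<^sup>2 u = (R' - C') - a (R - C)\<close> the terms with
  \<open>exp (a * z)\<close> cancel. The rest has rate at most \<open>t\<close> or 1/3, and division
  by \<open>f\<^sup>2\<close> gains 2/3.\<close>

lemma u_right:
  assumes bt: "b = of_real t * a" and t: "t < 1"
  shows "pgrow {z. 0 \<le> x z} (\<lambda>z. (max t (1 / 3) - 2 / 3) * x z) u"
proof (rule pgrow_divide_f_squared[OF bt t])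
  show "pgrow {z. 0 \<le> x z} (\<lambda>z. 1 / 3 * x z) u"
    by (rule pgrow_weaken[OF u_grow]) (auto simp: h_right[OF bt t])
  have "f z ^ 2 * u z = p2 * (b - a) * exp (b * z) + (a * C z - deriv C z)" for z
  proof -
    have "f z ^ 2 * u z = 3 * f z ^ 2 * deriv f z - a * f z ^ 3"
      by (simp add: u_def power2_eq_square power3_eq_cube algebra_simps)
    then show ?thesis unfolding f_cubed_deriv f_cubed by (simp add: R_def R'_def algebra_simps)
  qed
  moreover have "pgrow {z. 0 \<le> x z} (\<lambda>z. max t (1 / 3) * x z) (\<lambda>z. p2 * (b - a) * exp (b * z))"
    by (rule pgrow_weaken[OF pgrow_cmult[OF pgrow_exp]])
      (auto simp: Re_b[OF bt] intro: mult_right_mono simp del: times_complex.sel)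
  moreover have "pgrow {z. 0 \<le> x z} (\<lambda>z. max t (1 / 3) * x z) (\<lambda>z. a * C z - deriv C z)"
  proof (rule pgrow_weaken[OF pgrow_diff[OF pgrow_cmult[OF C_grow] C'_grow]])
    fix z assume "z \<in> {z. 0 \<le> x z}"
    then show "h z / 3 \<le> max t (1 / 3) * x z"
      using mult_right_mono[of "1 / 3" "max t (1 / 3)" "x z"] by (simp add: h_right[OF bt t])
  qed auto
  ultimately show "pgrow {z. 0 \<le> x z} (\<lambda>z. max t (1 / 3) * x z) (\<lambda>z. f z ^ 2 * u z)"
    by (simp add: pgrow_add)
qed

section \<open>Case analysis on the real ratio \<open>t\<close>\<close>

lemma halfplanes: "UNIV = {z. 0 \<le> x z} \<union> {z. x z \<le> 0}"
  by auto

text \<open>The factor \<open>exp (- b * z / 3)\<close> compensates the growth of \<open>u\<close>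
  on the left, where \<open>h z = t * x z\<close>, and on the right still leaves decay of rate
  \<open>(1 + t) / 3\<close>. Hence \<open>u = 0\<close>, and \<open>f\<close> is a multiple of
  \<open>exp (a * z / 3)\<close>.\<close>

lemma no_solution_neg_gt:
  assumes bt: "b = of_real t * a" and t: "-1 < t" "t < 0"
  shows False
proof -
  have m: "max t (1/3) = 1/3" using t by simp
  let ?F = "\<lambda>z. u z * exp ((- b / 3) * z)"
  have Reb: "Re ((- b / 3) * z) = - t / 3 * x z" for z
    using Re_b[OF bt, of z] by (simp add: algebra_simps)
  have "pgrow {z. 0 \<le> x z} (\<lambda>z. (1 / 3 - 2 / 3) * x z + - t / 3 * x z) ?F"
    using pgrow_mult[OF u_right[OF bt] pgrow_exp[of _ "- b / 3"]] t unfolding m Reb by simp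
  then have right: "pgrow {z. 0 \<le> x z} (\<lambda>z. - ((1 + t) / 3) * x z) ?F"
    by (rule pgrow_weaken) (auto simp: field_simps)
  have "pgrow {z. x z \<le> 0} (\<lambda>z. h z / 3 + - t / 3 * x z) ?F"
    using pgrow_mult[OF pgrow_weaken[OF u_grow subset_UNIV order_refl] pgrow_exp[of _ "- b / 3"]]
    unfolding Reb .
  moreover have "h z / 3 + - t / 3 * x z \<le> 0" if "x z \<le> 0" for z
    using mult_nonpos_nonpos[of t "x z"] that t
    unfolding h_def Re_b[OF bt] x_def[symmetric] by (simp add: max_def)
  ultimately have "pgrow {z. x z \<le> 0} (\<lambda>_. 0) ?F"
    by (elim pgrow_weaken) auto
  moreover have "pgrow {z. 0 \<le> x z} (\<lambda>_. 0) ?F"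
    by (rule pgrow_weaken[OF right]) (use t in auto)
  ultimately have "pgrow UNIV (\<lambda>_. 0) ?F" unfolding halfplanes by (rule pgrow_Un[rotated])
  moreover have "?F holomorphic_on UNIV" by (intro holomorphic_intros holomorphic_u)
  ultimately obtain P where P: "\<And>z. ?F z = poly P z" using pgrow_imp_poly by blast
  have "P = 0"
  proof (rule poly_decaying_eq_0[OF a])
    show "0 < (1 + t) / 3" using t by simp
    show "pgrow {z. 0 \<le> Re (a * z)} (\<lambda>z. - ((1 + t) / 3) * Re (a * z)) (poly P)"
      using right unfolding P x_def .
  qed
  then have "3 * deriv f z = a * f z" for z
    using P[of z] by (simp add: u_def)
  then have "deriv f z = a / 3 * f z" for z
    using nonzero_mult_div_cancel_left[of 3 "deriv f z"] by simp
  from deriv_proportional_imp_exp[OF hol this] obtain c where c: "\<And>z. f z = c * exp (a / 3 * z)"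
    by blast
  \<comment> \<open>The exponents 1, \<open>t\<close> and 1/3 are distinct because
    \<open>t < 0\<close>, so \<open>- p2\<close> stands alone as a coefficient and would have to
    vanish.\<close>
  have "\<forall>(s :: real, p)\<in>set [(1, [:c ^ 3 - p1:]), (t, [:- p2:]), (1/3, smult (c * (exp (a / 3) - 1)) q)]. p = 0"
  proof (rule exp_poly_independent_real[OF a])
    show "distinct (map fst [(1, [:c ^ 3 - p1:]), (t, [:- p2:]), (1/3, smult (c * (exp (a / 3) - 1)) q)])"
      using t by simp
    fix z
    have "exp (a * z) = exp (a / 3 * z) ^ 3" using exp_of_nat_mult[of 3 "a / 3 * z"] by simp
    moreover have "exp (a / 3 * (z + 1)) = exp (a / 3 * z) * exp (a / 3)" by (simp add: ring_distribs exp_add)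
    ultimately show "(\<Sum>(s, p)\<leftarrow>[(1, [:c ^ 3 - p1:]), (t, [:- p2:]), (1/3, smult (c * (exp (a / 3) - 1)) q)].
        poly p z * exp (of_real s * a * z)) = 0"
      using eq[of z] unfolding c by (simp add: bt algebra_simps power3_eq_cube)
  qed
  then show False using p2 by simp
qed

text \<open>Here \<open>u\<close> is polynomially bounded on both sides, since \<open>h = 0\<close>
  on the left, so it is a polynomial. Solving \<open>3 f' - a f = u\<close> gives \<open>f\<close>
  as a multiple of \<open>exp (a * z / 3)\<close> plus a polynomial \<open>g\<close>, and comparing
  coefficients leaves only \<open>t = 1 / 3\<close> and \<open>g = 0\<close>.\<close>

lemma solution_small_ratio:
  assumes bt: "b = of_real t * a" and t: "0 < t" "t \<le> 2 / 3"
  shows "degree q = 0 \<and> (\<exists>c. c ^ 3 = p1 \<and> c * (exp (a / 3) - 1) * coeff q 0 = p2 \<and> a = 3 * b \<and>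
    (\<forall>z. f z = c * exp (a * z / 3)))"
proof -
  have "pgrow {z. 0 \<le> x z} (\<lambda>_. 0) u"
    by (rule pgrow_weaken[OF u_right[OF bt]]) (use t in \<open>auto intro!: mult_nonpos_nonneg\<close>)
  moreover have "pgrow {z. x z \<le> 0} (\<lambda>_. 0) u"
    by (rule pgrow_weaken[OF u_grow]) (auto simp: h_left[OF bt t(1)])
  ultimately have "pgrow UNIV (\<lambda>_. 0) u" unfolding halfplanes by (rule pgrow_Un)
  then obtain r where r: "\<And>z. u z = poly r z" using pgrow_imp_poly[OF holomorphic_u] by blast
  obtain g where g: "pderiv g - smult (a / 3) g = smult (1 / 3) r"
    using poly_first_order_ode_solvable[of "a / 3"] a by auto
  have "deriv (\<lambda>z. f z - poly g z) z = a / 3 * (f z - poly g z)" for z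
  proof -
    have D: "deriv (\<lambda>z. f z - poly g z) z = deriv f z - poly (pderiv g) z"
      using holomorphic_derivI[OF hol, of z] by (intro DERIV_imp_deriv DERIV_diff poly_DERIV) auto
    have "3 * poly (pderiv g) z - a * poly g z = 3 * deriv f z - a * f z"
    proof -
      have "smult 3 (pderiv g - smult (a / 3) g) = r" unfolding g by simp
      from arg_cong[OF this, of "\<lambda>p. poly p z"] show ?thesis
        by (simp add: u_def right_diff_distrib flip: r)
    qed
    then have "3 * deriv (\<lambda>z. f z - poly g z) z = a * (f z - poly g z)"
      unfolding D by (simp add: algebra_simps)
    then show ?thesis
      using nonzero_mult_div_cancel_left[of 3 "deriv (\<lambda>z. f z - poly g z) z"] by simp
  qed
  moreover have "(\<lambda>z. f z - poly g z) holomorphic_on UNIV" by (intro holomorphic_intros hol)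
  ultimately obtain c where c: "\<And>z. f z - poly g z = c * exp (a / 3 * z)"
    using deriv_proportional_imp_exp by blast
  define E where "E z = exp (a / 3 * z)" for z
  define k where "k = exp (a / 3)"
  have f: "f z = c * E z + poly g z" for z using c[of z] by (simp add: E_def algebra_simps)
  have E1: "E (z + 1) = k * E z" for z by (simp add: E_def k_def ring_distribs exp_add)
  have Es: "exp (of_real 1 * a * z) = E z ^ 3" "exp (of_real (2/3) * a * z) = E z ^ 2"
      "exp (of_real (1/3) * a * z) = E z" "exp (of_real 0 * a * z) = 1" for z
    using exp_of_nat_mult[of 3 "a / 3 * z"] exp_of_nat_mult[of 2 "a / 3 * z"]
    by (simp_all add: E_def mult_ac)
  define G where "G = pcompose g [:1, 1:] - g"
  have G: "poly G z = poly g (z + 1) - poly g z" for z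
    by (simp add: G_def poly_pcompose add.commute)
  have id: "(c ^ 3 - p1) * E z ^ 3 + 3 * c ^ 2 * poly g z * E z ^ 2
      + (3 * c * poly g z ^ 2 + c * (k - 1) * poly q z) * E z + (poly g z ^ 3 + poly q z * poly G z)
      = p2 * exp (of_real t * a * z)" for z
    using eq[of z] Es(1)[of z] unfolding f E1 G bt
    by (simp add: algebra_simps power2_eq_square power3_eq_cube)
  note sums = list.map sum_list.Cons sum_list.Nil prod.case Es
  \<comment> \<open>The term with \<open>p2\<close> must be matched on the left; the range of
    \<open>t\<close> excludes the exponents 1 and 0, leaving 2/3 and 1/3.\<close>
  consider "t = 2 / 3" | "t = 1 / 3" | "t \<noteq> 2 / 3" "t \<noteq> 1 / 3" by blast
  then show ?thesis
  proof cases
    case 1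
    let ?xs = "[(1 :: real, [:c ^ 3 - p1:]), (2/3, smult (3 * c ^ 2) g - [:p2:]),
      (1/3, smult (3 * c) (g ^ 2) + smult (c * (k - 1)) q), (0, g ^ 3 + q * G)]"
    have "\<forall>(s, p)\<in>set ?xs. p = 0"
    proof (rule exp_poly_independent_real[OF a])
      fix z show "(\<Sum>(s, p)\<leftarrow>?xs. poly p z * exp (of_real s * a * z)) = 0"
        using id[of z] unfolding sums 1 by (simp add: algebra_simps)
    qed simp
    then have "c ^ 3 = p1" "smult (3 * c ^ 2) g = [:p2:]" "g ^ 3 + q * G = 0" by simp_all
    then have "c \<noteq> 0" using p1 by auto
    \<comment> \<open>A constant \<open>g\<close> has difference \<open>G = 0\<close>, so the
      exponent 0 gives \<open>g ^ 3 = 0\<close>, against \<open>3 * c ^ 2 * g = p2\<close>.\<close>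
    then have "degree g = 0" using arg_cong[OF \<open>smult _ g = _\<close>, of degree] by simp
    then obtain d where d: "g = [:d:]" by (rule degree_eq_zeroE)
    then have "g ^ 3 = 0" using \<open>g ^ 3 + q * G = 0\<close> by (simp add: G_def)
    then have "g = 0" by simp
    then show ?thesis using \<open>smult (3 * c ^ 2) g = [:p2:]\<close> p2 by simp
  next
    case 2
    let ?xs = "[(1 :: real, [:c ^ 3 - p1:]), (2/3, smult (3 * c ^ 2) g),
      (1/3, smult (3 * c) (g ^ 2) + smult (c * (k - 1)) q - [:p2:]), (0, g ^ 3 + q * G)]"
    have "\<forall>(s, p)\<in>set ?xs. p = 0"
    proof (rule exp_poly_independent_real[OF a])
      fix z show "(\<Sum>(s, p)\<leftarrow>?xs. poly p z * exp (of_real s * a * z)) = 0"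
        using id[of z] unfolding sums 2 by (simp add: algebra_simps)
    qed simp
    then have eqs: "c ^ 3 = p1" "smult (3 * c ^ 2) g = 0"
        "smult (3 * c) (g ^ 2) + smult (c * (k - 1)) q = [:p2:]" by simp_all
    then have "c \<noteq> 0" using p1 by auto
    then have "g = 0" using eqs(2) by simp
    then have *: "smult (c * (k - 1)) q = [:p2:]" using eqs(3) by simp
    then have "c * (k - 1) \<noteq> 0" using p2 by auto
    then have "degree q = 0" using arg_cong[OF *, of degree] by simp
    moreover have "c * (k - 1) * coeff q 0 = p2" using arg_cong[OF *, of "\<lambda>p. coeff p 0"] by simp
    moreover have "3 * b = a" unfolding bt 2 by simp
    moreover have "f z = c * exp (a * z / 3)" for z using f[of z] \<open>g = 0\<close> by (simp add: E_def)
    ultimately show ?thesis using eqs(1) unfolding k_def by (metis (no_types))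
  next
    case 3
    let ?xs = "[(1 :: real, [:c ^ 3 - p1:]), (2/3, smult (3 * c ^ 2) g),
      (1/3, smult (3 * c) (g ^ 2) + smult (c * (k - 1)) q), (0, g ^ 3 + q * G), (t, [:- p2:])]"
    have "\<forall>(s, p)\<in>set ?xs. p = 0"
    proof (rule exp_poly_independent_real[OF a])
      show "distinct (map fst ?xs)" using t 3 by auto
      fix z show "(\<Sum>(s, p)\<leftarrow>?xs. poly p z * exp (of_real s * a * z)) = 0"
        using id[of z] unfolding sums by (simp add: algebra_simps)
    qed
    then show ?thesis using p2 by simp
  qed
qed

lemma R_grow: "pgrow UNIV h R"
  by (rule pgrowI[where K = "norm p1 + norm p2" and D = 0]) (simp add: R_le)

lemma R'_grow: "pgrow UNIV h R'"
  unfolding R'_def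
  by (intro pgrow_add pgrow_weaken[OF pgrow_cmult[OF pgrow_exp]])
    (auto simp: h_def simp del: times_complex.sel)

text \<open>Where the two terms of \<open>R\<close> cancel, those of \<open>R'\<close> add up to
  \<open>(b - a) * p2 * exp (b * z)\<close>, which never vanishes.\<close>

lemma R_simple_zero: obtains z where "R z = 0" "R' z \<noteq> 0"
proof -
  define z where "z = Ln (- p2 / p1) / (a - b)"
  have "exp ((a - b) * z) = - p2 / p1" using ab p1 p2 by (simp add: z_def)
  then have "p1 * exp (a * z) = - p2 * exp (b * z)"
    using p1 by (simp add: left_diff_distrib exp_diff field_simps)
  then have "R z = 0" "R' z = (b - a) * p2 * exp (b * z)"
    by (simp add: R_def) (simp add: R'_def mult.assoc left_diff_distrib \<open>p1 * _ = _\<close>)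
  then show thesis using that ab p2 by simp
qed

lemma R_nonzero: obtains z where "R z \<noteq> 0"
proof -
  have "\<exists>z. R z \<noteq> 0"
  proof (rule ccontr)
    assume "\<not> ?thesis"
    then have "R = (\<lambda>z. 0)" by auto
    obtain z where "R' z \<noteq> 0" using R_simple_zero by blast
    then show False using R_deriv[of z] DERIV_unique[OF _ DERIV_const] unfolding \<open>R = _\<close> by blast
  qed
  then show thesis using that by blast
qed

text \<open>At a simple zero of \<open>R\<close> the cube would have vanishing derivative, which
  forces \<open>c = 0\<close>. Then \<open>f = 0\<close>, and the equation makes \<open>R\<close>
  vanish identically.\<close>

lemma not_proportional:
  assumes "\<And>z. f z ^ 3 = c * R z"
  shows False
proof -
  obtain z0 where z0: "R z0 = 0" "R' z0 \<noteq> 0" using R_simple_zero by blast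
  obtain z1 where z1: "R z1 \<noteq> 0" using R_nonzero by blast
  have "((\<lambda>z. f z ^ 3) has_field_derivative 3 * f z0 ^ 2 * deriv f z0) (at z0)"
    using holomorphic_derivI[OF hol, of z0] by (auto intro!: derivative_eq_intros simp: algebra_simps power2_eq_square)
  moreover have "((\<lambda>z. f z ^ 3) has_field_derivative c * R' z0) (at z0)"
    unfolding assms by (intro DERIV_cmult R_deriv)
  ultimately have "3 * f z0 ^ 2 * deriv f z0 = c * R' z0" by (rule DERIV_unique)
  moreover have "f z0 = 0" using assms[of z0] z0 by simp
  ultimately have "c = 0" using z0 by simp
  then have "f z = 0" for z using assms[of z] by simp
  then show False using f_cubed[of z1] z1 by (simp add: C_def)
qed

text \<open>For \<open>t > 2 / 3\<close> the bound on \<open>u\<close> allows exponential growth, so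
  \<open>W\<close> replaces it: \<open>f\<^sup>2 W = C R' - C' R\<close> gives rate 2/3 on the
  right, which \<open>exp (- b * z)\<close> turns into decay. On the left \<open>R\<close> and
  \<open>R'\<close> are of order \<open>exp (b * z)\<close>, which this factor cancels. Hence
  \<open>W = 0\<close>.\<close>

lemma no_solution_large_ratio:
  assumes bt: "b = of_real t * a" and t: "2 / 3 < t" "t < 1"
  shows False
proof -
  define W where "W z = 3 * (deriv f z * R z) - f z * R' z" for z
  let ?F = "\<lambda>z. W z * exp (- b * z)"
  have t0: "0 < t" using t by simp
  have Reb: "Re (- b * z) = - t * x z" for z using Re_b[OF bt, of z] by simp
  have W: "pgrow UNIV (\<lambda>z. h z / 3 + h z) W" unfolding W_def
    by (intro pgrow_diff pgrow_cmult pgrow_mult f_grow f'_grow R_grow R'_grow)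
  have "f z ^ 2 * W z = C z * R' z - deriv C z * R z" for z
  proof -
    have "f z ^ 2 * W z = (3 * f z ^ 2 * deriv f z) * R z - f z ^ 3 * R' z"
      by (simp add: W_def power2_eq_square power3_eq_cube algebra_simps)
    then show ?thesis unfolding f_cubed_deriv f_cubed by (simp add: algebra_simps)
  qed
  then have f2W: "pgrow UNIV (\<lambda>z. h z / 3 + h z) (\<lambda>z. f z ^ 2 * W z)"
    by (simp only:) (intro pgrow_diff pgrow_mult C_grow C'_grow R_grow R'_grow)
  have "pgrow {z. 0 \<le> x z} (\<lambda>z. (4 / 3 - 2 / 3) * x z) W"
    by (rule pgrow_divide_f_squared[OF bt t(2) pgrow_weaken[OF W, where k' = "\<lambda>z. 4 / 3 * x z"] pgrow_weaken[OF f2W]])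
      (auto simp: h_right[OF bt t(2)])
  from pgrow_mult[OF this pgrow_exp[of _ "- b"]]
  have right: "pgrow {z. 0 \<le> x z} (\<lambda>z. - (t - 2 / 3) * x z) ?F"
    unfolding Reb by (rule pgrow_weaken) (auto simp: algebra_simps)
  have left_exp: "pgrow {z. x z \<le> 0} (\<lambda>z. t * x z) (\<lambda>z. c * exp (a * z) + d * exp (b * z))" for c d
  proof (intro pgrow_add pgrow_weaken[OF pgrow_cmult[OF pgrow_exp]])
    fix z assume "z \<in> {z. x z \<le> 0}"
    then show "Re (a * z) \<le> t * x z"
      using t mult_right_mono_neg[of t 1 "x z"] by (simp add: x_def del: times_complex.sel)
  qed (auto simp: Re_b[OF bt] simp del: times_complex.sel)
  have "pgrow {z. x z \<le> 0} (\<lambda>z. h z / 3 + t * x z) W"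
    unfolding W_def R_def R'_def
    by (intro pgrow_diff pgrow_cmult pgrow_mult left_exp pgrow_weaken[OF f_grow subset_UNIV]
        pgrow_weaken[OF f'_grow subset_UNIV] order_refl)
  from pgrow_mult[OF this pgrow_exp[of _ "- b"]]
  have "pgrow {z. x z \<le> 0} (\<lambda>_. 0) ?F"
    unfolding Reb by (rule pgrow_weaken) (auto simp: h_left[OF bt t0])
  moreover have "pgrow {z. 0 \<le> x z} (\<lambda>_. 0) ?F"
    by (rule pgrow_weaken[OF right]) (use t in \<open>auto intro!: mult_nonpos_nonneg\<close>)
  ultimately have "pgrow UNIV (\<lambda>_. 0) ?F" unfolding halfplanes by (rule pgrow_Un[rotated])
  moreover have "?F holomorphic_on UNIV"
    unfolding W_def R_def R'_def by (intro holomorphic_intros hol holomorphic_f')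
  ultimately obtain P where P: "\<And>z. ?F z = poly P z" using pgrow_imp_poly by blast
  have "P = 0"
  proof (rule poly_decaying_eq_0[OF a])
    show "0 < t - 2 / 3" using t by simp
    show "pgrow {z. 0 \<le> Re (a * z)} (\<lambda>z. - (t - 2 / 3) * Re (a * z)) (poly P)"
      using right unfolding P x_def .
  qed
  then have W0: "W z = 0" for z using P[of z] by simp
  \<comment> \<open>\<open>W = 0\<close> says that \<open>f ^ 3 / R\<close> has derivative 0. It is
    constant on a disc free of zeros of \<open>R\<close>, and the identity theorem extends the
    proportionality to the plane.\<close>
  obtain z1 where z1: "R z1 \<noteq> 0" using R_nonzero by blast
  have contR: "continuous_on UNIV R" by (simp add: R_def continuous_intros)
  have "open {z. R z \<noteq> 0}"
    using open_Collect_neq[OF contR continuous_on_const] .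
  then obtain e where e: "0 < e" "ball z1 e \<subseteq> {z. R z \<noteq> 0}"
    using z1 open_contains_ball by blast
  have "((\<lambda>z. f z ^ 3 / R z) has_field_derivative 0) (at z within ball z1 e)" if "z \<in> ball z1 e" for z
  proof -
    have Rz: "R z \<noteq> 0" using that e by blast
    have "3 * f z ^ 2 * deriv f z * R z - f z ^ 3 * R' z = f z ^ 2 * W z"
      by (simp add: W_def power2_eq_square power3_eq_cube algebra_simps)
    then have "((\<lambda>z. f z ^ 3 / R z) has_field_derivative 0) (at z)"
      using Rz W0 holomorphic_derivI[OF hol, of z] R_deriv[of z]
      by (auto intro!: derivative_eq_intros simp: power2_eq_square mult_ac)
    then show ?thesis by (rule has_field_derivative_at_within)
  qed
  then obtain c where c: "\<And>z. z \<in> ball z1 e \<Longrightarrow> f z ^ 3 / R z = c"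
    using has_field_derivative_zero_constant[of "ball z1 e" "\<lambda>z. f z ^ 3 / R z"] by auto
  have "f z ^ 3 - c * R z = 0" for z
  proof (rule analytic_continuation_open[of "ball z1 e" UNIV "\<lambda>z. f z ^ 3 - c * R z" "\<lambda>z. 0" z])
    show "(\<lambda>z. f z ^ 3 - c * R z) holomorphic_on UNIV"
      unfolding R_def by (intro holomorphic_intros hol)
    show "f z ^ 3 - c * R z = 0" if "z \<in> ball z1 e" for z
    proof -
      have "R z \<noteq> 0" using that e by blast
      then show ?thesis using c[OF that] by (simp add: field_simps)
    qed
  qed (use e in auto)
  then show False using not_proportional[of c] by simp
qed

text \<open>The factor \<open>exp (a * z / 3)\<close> brings the exponent of \<open>u\<close> to 0
  in both half-planes. Unlike for \<open>-1 < t < 0\<close>, no decay is left, so the polynomial may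
  be nonzero.\<close>

lemma u_opposite:
  assumes ba: "b = - a"
  shows "\<exists>P. \<forall>z. u z = poly P z * exp (b / 3 * z)"
proof -
  have bt: "b = of_real (-1) * a" using ba by simp
  let ?F = "\<lambda>z. u z * exp (a / 3 * z)"
  have Rea: "Re (a / 3 * z) = x z / 3" for z by (simp add: x_def)
  have "-1 < (1 :: real)" by simp
  from pgrow_mult[OF u_right[OF bt this] pgrow_exp[of _ "a / 3"]]
  have "pgrow {z. 0 \<le> x z} (\<lambda>_. 0) ?F"
    unfolding Rea by (elim pgrow_weaken) auto
  moreover have "pgrow {z. x z \<le> 0} (\<lambda>_. 0) ?F"
    using pgrow_mult[OF u_grow pgrow_exp[of _ "a / 3"]] unfolding Rea
    by (rule pgrow_weaken) (auto simp: h_def Re_b[OF bt] x_def[symmetric] simp del: times_complex.sel)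
  ultimately have "pgrow UNIV (\<lambda>_. 0) ?F" unfolding halfplanes by (rule pgrow_Un)
  moreover have "?F holomorphic_on UNIV" by (intro holomorphic_intros holomorphic_u)
  ultimately obtain P where P: "\<And>z. ?F z = poly P z" using pgrow_imp_poly by blast
  have "u z = poly P z * exp (b / 3 * z)" for z
    unfolding P[symmetric] ba by (simp add: mult.assoc flip: exp_add)
  then show ?thesis by blast
qed

text \<open>Makes every result available with the exponentials exchanged, which replaces the ratio
  \<open>t\<close> by \<open>1 / t\<close>.\<close>

lemma swapped: "cubic_difference_equation q p2 p1 b a f"
  using p1 p2 a b ab hol ho eq by unfold_locales (auto simp: add.commute)

text \<open>Both orders of the exponentials give a first-order relation for \<open>f\<close>;
  subtracting them eliminates \<open>f'\<close> and yields \<open>A * E + B * E'\<close> with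
  polynomials \<open>A\<close> and \<open>B\<close>. The extreme exponents force
  \<open>A ^ 3 = p1\<close> and \<open>B ^ 3 = p2\<close>, so both are constant.\<close>

lemma solution_opposite:
  assumes ba: "b = - a"
  shows "degree q = 0 \<and> (\<exists>e1 e2. e1 \<noteq> 0 \<and> e2 \<noteq> 0 \<and> e1 ^ 3 = p1 \<and> e2 ^ 3 = p2 \<and>
    3 * e1 * e2 - 2 * coeff q 0 = 0 \<and> exp (a / 3) = -1 \<and>
    (\<forall>z. f z = e1 * exp (a * z / 3) + e2 * exp (b * z / 3)))"
proof -
  interpret sw: cubic_difference_equation q p2 p1 b a f by (rule swapped)
  define E where "E z = exp (a / 3 * z)" for z
  define E' where "E' z = exp (b / 3 * z)" for z
  obtain P where P: "\<And>z. u z = poly P z * E' z"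
    using u_opposite[OF ba] unfolding E'_def by blast
  obtain P' where P': "\<And>z. sw.u z = poly P' z * E z"
    using sw.u_opposite ba unfolding E_def by auto
  define A B where "A = smult (- 1 / (b - a)) P'" and "B = smult (1 / (b - a)) P"
  have f: "f z = poly A z * E z + poly B z * E' z" for z
  proof -
    have "(b - a) * f z = poly P z * E' z - poly P' z * E z"
      unfolding P[symmetric] P'[symmetric] u_def sw.u_def by (simp add: algebra_simps)
    then have "f z = (poly P z * E' z - poly P' z * E z) / (b - a)"
      using ab by (simp add: eq_divide_eq mult.commute)
    then show ?thesis by (simp add: A_def B_def diff_divide_distrib)
  qed
  define k k' where "k = exp (a / 3)" and "k' = exp (b / 3)"
  have kk': "k * k' = 1" by (simp add: k_def k'_def ba flip: exp_add)
  have E1: "E (z + 1) = k * E z" "E' (z + 1) = k' * E' z" for z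
    by (simp_all add: E_def E'_def k_def k'_def ring_distribs exp_add)
  have EE': "E z * E' z = 1" for z by (simp add: E_def E'_def ba flip: exp_add)
  have Es: "exp (of_real 1 * a * z) = E z ^ 3" "exp (of_real (1/3) * a * z) = E z"
      "exp (of_real (-1/3) * a * z) = E' z" "exp (of_real (-1) * a * z) = E' z ^ 3" for z
    using exp_of_nat_mult[of 3 "a / 3 * z"] exp_of_nat_mult[of 3 "b / 3 * z"]
    by (simp_all add: E_def E'_def ba mult_ac)
  define A1 B1 where "A1 = pcompose A [:1, 1:]" and "B1 = pcompose B [:1, 1:]"
  have A1: "poly A1 z = poly A (z + 1)" "poly B1 z = poly B (z + 1)" for z
    by (simp_all add: A1_def B1_def poly_pcompose add.commute)
  let ?xs = "[(1 :: real, A ^ 3 - [:p1:]), (1/3, smult 3 (A ^ 2 * B) + q * (smult k A1 - A)),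
    (-1/3, smult 3 (A * B ^ 2) + q * (smult k' B1 - B)), (-1, B ^ 3 - [:p2:])]"
  have "\<forall>(s, p)\<in>set ?xs. p = 0"
  proof (rule exp_poly_independent_real[OF a])
    fix z
    define X Y where "X = poly A z * E z" and "Y = poly B z * E' z"
    have XY: "(X + Y) ^ 3 = poly A z ^ 3 * E z ^ 3 + 3 * poly A z ^ 2 * poly B z * E z * (E z * E' z)
        + 3 * poly A z * poly B z ^ 2 * E' z * (E z * E' z) + poly B z ^ 3 * E' z ^ 3"
      by (simp add: X_def Y_def algebra_simps power2_eq_square power3_eq_cube)
    have "(X + Y) ^ 3 + poly q z * (poly A (z + 1) * (k * E z) + poly B (z + 1) * (k' * E' z) - (X + Y))
        = p1 * E z ^ 3 + p2 * E' z ^ 3"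
      using eq[of z] Es(1)[of z] Es(4)[of z] unfolding f E1 by (simp add: X_def Y_def ba)
    then show "(\<Sum>(s, p)\<leftarrow>?xs. poly p z * exp (of_real s * a * z)) = 0"
      unfolding list.map sum_list.Cons sum_list.Nil prod.case Es XY EE'
      by (simp add: A1 X_def Y_def algebra_simps)
  qed simp
  then have AB: "A ^ 3 = [:p1:]" "B ^ 3 = [:p2:]"
      "smult 3 (A ^ 2 * B) + q * (smult k A1 - A) = 0"
      "smult 3 (A * B ^ 2) + q * (smult k' B1 - B) = 0" by simp_all
  have "A \<noteq> 0" "B \<noteq> 0" using AB(1,2) p1 p2 by auto
  then have "3 * degree A = 0" "3 * degree B = 0"
    using arg_cong[OF AB(1), of degree] arg_cong[OF AB(2), of degree] by (simp_all add: degree_power_eq)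
  then obtain e1 e2 where e: "A = [:e1:]" "B = [:e2:]"
    by (metis degree_eq_zeroE mult_eq_0_iff zero_neq_numeral)
  have cube: "e1 ^ 3 = p1" "e2 ^ 3 = p2" using AB(1,2) by (simp_all add: e power3_eq_cube mult.assoc)
  then have e0: "e1 \<noteq> 0" "e2 \<noteq> 0" using p1 p2 by auto
  have q1: "[:3 * e1 ^ 2 * e2:] + smult ((k - 1) * e1) q = 0"
    using AB(3) by (simp add: e A1_def algebra_simps power2_eq_square smult_diff_left)
  have q2: "[:3 * e1 * e2 ^ 2:] + smult ((k' - 1) * e2) q = 0"
    using AB(4) by (simp add: e B1_def algebra_simps power2_eq_square smult_diff_left)
  have "(k - 1) * e1 \<noteq> 0" using q1 e0 by auto
  moreover have "smult ((k - 1) * e1) q = [:- (3 * e1 ^ 2 * e2):]"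
    using q1 by (simp add: add_eq_0_iff)
  ultimately have "degree q = 0" by (metis degree_pCons_0 degree_smult_eq)
  then obtain d where d: "q = [:d:]" by (rule degree_eq_zeroE)
  \<comment> \<open>Subtracting the conditions from the exponents 1/3 and -1/3 gives
    \<open>k = k'\<close>. With \<open>k * k' = 1\<close> only 1 and -1 remain, and
    \<open>k = 1\<close> would give \<open>e1 * e2 = 0\<close>.\<close>
  have "e1 * (3 * e1 * e2 + (k - 1) * d) = 0" "e2 * (3 * e1 * e2 + (k' - 1) * d) = 0"
    using q1 q2 by (simp_all add: d algebra_simps power2_eq_square)
  then have eqs: "3 * e1 * e2 + (k - 1) * d = 0" "3 * e1 * e2 + (k' - 1) * d = 0" using e0 by simp_all
  then have "d \<noteq> 0" using e0 by auto
  moreover have "(k - k') * d = (3 * e1 * e2 + (k - 1) * d) - (3 * e1 * e2 + (k' - 1) * d)"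
    by (simp add: algebra_simps)
  then have "(k - k') * d = 0" unfolding eqs by simp
  ultimately have "k = k'" by simp
  then have "k = 1 \<or> k = -1" using kk' by (simp flip: power2_eq_square add: power2_eq_1_iff)
  moreover have "k \<noteq> 1" using eqs(1) e0 by auto
  ultimately have "k = -1" by simp
  moreover have "3 * e1 * e2 - 2 * d = 0" using eqs(1) unfolding \<open>k = -1\<close> by simp
  moreover have "f z = e1 * exp (a * z / 3) + e2 * exp (b * z / 3)" for z
    using f[of z] by (simp add: e E_def E'_def)
  ultimately show ?thesis using \<open>degree q = 0\<close> cube e0 d unfolding k_def by auto
qed

section \<open>Assembly of the cases and reduction by symmetry\<close>

lemma solution_ratio_lt_1:
  assumes bt: "b = of_real t * a" and t: "-1 \<le> t" "t < 1"
  shows "degree q = 0 \<and>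
    ((\<exists>e1 e2. e1 \<noteq> 0 \<and> e2 \<noteq> 0 \<and> e1 ^ 3 = p1 \<and> e2 ^ 3 = p2 \<and>
       3 * e1 * e2 - 2 * coeff q 0 = 0 \<and> a + b = 0 \<and> exp (a / 3) = -1 \<and>
       (\<forall>z. f z = e1 * exp (a * z / 3) + e2 * exp (b * z / 3))) \<or>
     (\<exists>c. c ^ 3 = p1 \<and> c * (exp (a / 3) - 1) * coeff q 0 = p2 \<and> a = 3 * b \<and>
       (\<forall>z. f z = c * exp (a * z / 3))))"
proof -
  have "t \<noteq> 0" using bt b by auto
  then consider "t = -1" | "-1 < t" "t < 0" | "0 < t" "t \<le> 2 / 3" | "2 / 3 < t"
    using t by linarith
  then show ?thesis
  proof cases
    case 1
    then have "b = - a" using bt by simp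
    from solution_opposite[OF this] this show ?thesis by auto
  next
    case 2
    then show ?thesis using no_solution_neg_gt[OF bt] by blast
  next
    case 3
    from solution_small_ratio[OF bt this] show ?thesis by blast
  next
    case 4
    then show ?thesis using no_solution_large_ratio[OF bt] t by blast
  qed
qed

end

theorem theorem1p1:
  fixes q :: "complex poly" and p1 p2 \<alpha>1 \<alpha>2 :: complex and f :: "complex \<Rightarrow> complex"
  assumes "p1 \<noteq> 0" "p2 \<noteq> 0" "\<alpha>1 \<noteq> 0" "\<alpha>2 \<noteq> 0" "\<alpha>1 \<noteq> \<alpha>2"
    and "f holomorphic_on UNIV"
    and "hyper_order f < 1"
    and "\<And>z. (f z)^3 + poly q z * (f (z + 1) - f z) = p1 * exp (\<alpha>1 * z) + p2 * exp (\<alpha>2 * z)"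
  shows "degree q = 0 \<and>
    ((\<exists>e1 e2. e1 \<noteq> 0 \<and> e2 \<noteq> 0 \<and>
        ((e1^3 = p1 \<and> e2^3 = p2) \<or> (e1^3 = p2 \<and> e2^3 = p1)) \<and>
        3 * e1 * e2 - 2 * coeff q 0 = 0 \<and> \<alpha>1 + \<alpha>2 = 0 \<and> exp (\<alpha>1 / 3) = -1 \<and>
        (\<forall>z. f z = e1 * exp (\<alpha>1 * z / 3) + e2 * exp (\<alpha>2 * z / 3)))
     \<or> (\<exists>c1. c1^3 = p1 \<and> c1 * (exp (\<alpha>1 / 3) - 1) * coeff q 0 = p2 \<and> \<alpha>1 = 3 * \<alpha>2 \<and>
        (\<forall>z. f z = c1 * exp (\<alpha>1 * z / 3)))
     \<or> (\<exists>c2. c2^3 = p2 \<and> c2 * (exp (\<alpha>2 / 3) - 1) * coeff q 0 = p1 \<and> \<alpha>2 = 3 * \<alpha>1 \<and>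
        (\<forall>z. f z = c2 * exp (\<alpha>2 * z / 3))))"
proof -
  interpret eq: cubic_difference_equation q p1 p2 \<alpha>1 \<alpha>2 f
    using assms by unfold_locales
  interpret sw: cubic_difference_equation q p2 p1 \<alpha>2 \<alpha>1 f
    by (rule eq.swapped)
  obtain t :: real where t: "\<alpha>2 = of_real t * \<alpha>1" using eq.collinear by blast
  have "t \<noteq> 0" "t \<noteq> 1" using t assms by auto
  \<comment> \<open>Exchanging the exponentials moves a ratio above 1 into (0, 1), and one below -1
    into (-1, 0), where no solution exists.\<close>
  then have t': "\<alpha>1 = of_real (1 / t) * \<alpha>2" using t by simp
  consider "-1 \<le> t" "t < 1" | "1 < t" | "t < -1" using \<open>t \<noteq> 1\<close> by linarith
  then show ?thesis
  proof cases
    case 1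
    from eq.solution_ratio_lt_1[OF t this] show ?thesis by blast
  next
    case 2
    then have t1: "0 < 1 / t" "1 / t < 1" by simp_all
    \<comment> \<open>This discards the two-term alternative of the exchanged equation, whose other
      alternative is the third one of the claim.\<close>
    have "\<alpha>1 + \<alpha>2 \<noteq> 0"
    proof
      assume "\<alpha>1 + \<alpha>2 = 0"
      then have "of_real (1 + t) * \<alpha>1 = 0" using t by (simp add: algebra_simps)
      then show False using 2 assms(3) by (simp del: of_real_add)
    qed
    then show ?thesis using sw.solution_ratio_lt_1[OF t'] t1 by (auto simp: add.commute)
  next
    case 3
    then have "-1 < 1 / t" "1 / t < 0" by (simp_all add: field_simps)
    then show ?thesis using sw.no_solution_neg_gt[OF t'] by blast
  qed
qed

end
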